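(* Suppose that $\mathbf{x}_1,\dotsc,\mathbf{x}_k$ are independent tuples of variables. For each $i$, $1 \leq i \leq k$, let $V_i$ be the complex vector space with basis $\mathbf{x}_i$, and let $F_i(\mathbf{x}_i)$ be a $d$-form which is concise with respect to $\mathbf{x}_i$. Let $F = F_1 + \dotsb + F_k$ and let $V = \bigoplus_{i=1}^k V_i$. Consider $\Sigma_a(F_i) \subset V_i^*$ for each $i$ and $\Sigma_a(F) \subset V^*$. Let $1 \leq a \leq d-1$ be such that for each $i$, $$\operatorname{rk}(F_i) = \dim \operatorname{Derivs}(F_i)_{d-a} + \dim \Sigma_a(F_i).$$ Then $F = F_1 + \dotsb + F_k$ is concise with respect to $\mathbf{x} = (\mathbf{x}_1,\dotsc,\mathbf{x}_k)$ and $$\operatorname{rk}(F) = \dim \operatorname{Derivs}(F)_{d-a} + \dim \Sigma_a(F) = \sum_{i=1}^k \operatorname{rk}(F_i).$$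
   Context: All polynomials have complex coefficients. A $d$-form is a homogeneous polynomial of degree $d$. Tuples of variables are independent if they consist of pairwise disjoint sets of variables of one polynomial ring. The Waring rank $\operatorname{rk}(F)$ of a $d$-form $F$ is the least $r$ such that $F = \ell_1^d + \dotsb + \ell_r^d$ for some linear forms $\ell_1,\dotsc,\ell_r$. $\operatorname{Derivs}(F)_b$ is the vector space of $b$-forms spanned by the $(d-b)$th order partial derivatives of $F$. If $V$ is the complex vector space with basis a tuple of variables $\mathbf{x}$, a $d$-form $F \in S^d V = \mathbb{C}[\mathbf{x}]_d$ is regarded as a polynomial function on the affine space $V^*$. $F$ is concise with respect to $\mathbf{x}$ if it cannot be written as a form in fewer variables even after a linear change of coordinates: if $F \in S^d W$ for some linear subspace $W \subseteq V$, then $W = V$. For $0 \leq a \leq d-1$, $\Sigma_a(F) = \{ p \in V^* : \operatorname{mult}_p(F) > a\}$ is the set of points at which $F$ vanishes with multiplicity strictly greater than $a$ (i.e. all partial derivatives of $F$ of order at most $a$, including $F$ itself, vanish at $p$); it is an algebraic subset of the affine space $V^*$ (scheme structure is ignored), and $\dim \Sigma_a(F)$ is its dimension as an affine algebraic set. *)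

theory Defs
  imports Complex_Main "HOL-Library.Poly_Mapping" "HOL-Library.Extended_Nat"
    "HOL-Library.Disjoint_Sets"
begin

text \<open>
  A polynomial with complex coefficients in variables of type \<open>'v\<close> maps monomials (exponent
  functions of finite support) to coefficients; its ring structure is the one of
  \<^theory>\<open>HOL-Library.Poly_Mapping\<close>. A tuple of variables is represented by the finite set of its
  entries; the order of the entries plays no role.
\<close>

type_synonym 'v cpoly = "('v \<Rightarrow>\<^sub>0 nat) \<Rightarrow>\<^sub>0 complex"

definition cscale :: "complex \<Rightarrow> 'v cpoly \<Rightarrow> 'v cpoly" where
  "cscale c p = Poly_Mapping.map ((*) c) p"

lemma cscale_eq_mult: "cscale c p = Poly_Mapping.single 0 c * p"
  by (simp add: cscale_def mult_map_scale_conv_mult)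

global_interpretation cpoly: vector_space "cscale :: complex \<Rightarrow> 'v cpoly \<Rightarrow> 'v cpoly"
  by unfold_locales
    (simp_all add: cscale_eq_mult algebra_simps single_add mult_single flip: mult.assoc)

definition polys :: "'v set \<Rightarrow> 'v cpoly set" where
  "polys X = {p. \<forall>m\<in>Poly_Mapping.keys p. Poly_Mapping.keys m \<subseteq> X}"

definition mdegree :: "('v \<Rightarrow>\<^sub>0 nat) \<Rightarrow> nat" where
  "mdegree m = (\<Sum>v\<in>Poly_Mapping.keys m. Poly_Mapping.lookup m v)"

text \<open>
  \<open>forms X d\<close> is the space of \<open>d\<close>-forms in the variables \<open>X\<close> (including 0). In particular
  \<open>forms X 1\<close> is the space \<open>V\<close> of linear forms, which has \<open>X\<close> as a basis.
\<close>

definition forms :: "'v set \<Rightarrow> nat \<Rightarrow> 'v cpoly set" where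
  "forms X d = {p \<in> polys X. \<forall>m\<in>Poly_Mapping.keys p. mdegree m = d}"

text \<open>The symmetric power \<open>S\<^sup>d W\<close> of a space \<open>W\<close> of linear forms, as a space of polynomials.\<close>

definition sym_power :: "nat \<Rightarrow> 'v cpoly set \<Rightarrow> 'v cpoly set" where
  "sym_power d W = cpoly.span {\<Prod>i<d. w i | w. \<forall>i<d. w i \<in> W}"

definition concise :: "'v set \<Rightarrow> nat \<Rightarrow> 'v cpoly \<Rightarrow> bool" where
  "concise X d F \<longleftrightarrow>
    (\<forall>W. cpoly.subspace W \<and> W \<subseteq> forms X 1 \<and> F \<in> sym_power d W \<longrightarrow> W = forms X 1)"

text \<open>
  The degree \<open>d\<close> is passed explicitly since the zero polynomial is a \<open>d\<close>-form for every \<open>d\<close>.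
  The value is in \<^typ>\<open>enat\<close>, so that no junk value arises if there is no decomposition
  (the infimum is then \<open>\<infinity>\<close>).
\<close>

definition waring_rank :: "nat \<Rightarrow> 'v cpoly \<Rightarrow> enat" where
  "waring_rank d F =
    Inf {enat r | r. \<exists>l. (\<forall>i<r. l i \<in> forms UNIV 1) \<and> F = (\<Sum>i<r. l i ^ d)}"

text \<open>
  Exponents are subtracted in \<^typ>\<open>nat\<close>; a monomial in which \<open>v\<close> does not occur contributes
  the coefficient 0.
\<close>

definition partial_deriv :: "'v \<Rightarrow> 'v cpoly \<Rightarrow> 'v cpoly" where
  "partial_deriv v p = (\<Sum>m\<in>Poly_Mapping.keys p.
    Poly_Mapping.single (m - Poly_Mapping.single v 1) (of_nat (Poly_Mapping.lookup m v) * Poly_Mapping.lookup p m))"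

text \<open>The iterated derivative with respect to all entries of a list, of order the length of the list.\<close>

definition partial_derivs :: "'v list \<Rightarrow> 'v cpoly \<Rightarrow> 'v cpoly" where
  "partial_derivs vs p = fold partial_deriv vs p"

definition derivs_space :: "'v set \<Rightarrow> nat \<Rightarrow> 'v cpoly \<Rightarrow> nat \<Rightarrow> 'v cpoly set" where
  "derivs_space X d F b =
    cpoly.span {partial_derivs vs F | vs. set vs \<subseteq> X \<and> length vs = d - b}"

text \<open>
  A point of \<open>V\<^sup>*\<close>, i.e. a linear functional on \<open>V\<close>, is given by its values on the basis \<open>X\<close>, extended
  by 0 to the other variables.
\<close>

definition dual_space :: "'v set \<Rightarrow> ('v \<Rightarrow> complex) set" where
  "dual_space X = {p. \<forall>v. v \<notin> X \<longrightarrow> p v = 0}"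

definition cpoly_eval :: "('v \<Rightarrow> complex) \<Rightarrow> 'v cpoly \<Rightarrow> complex" where
  "cpoly_eval p f = (\<Sum>m\<in>Poly_Mapping.keys f. Poly_Mapping.lookup f m * (\<Prod>v\<in>Poly_Mapping.keys m. p v ^ Poly_Mapping.lookup m v))"

definition Sigma_locus :: "'v set \<Rightarrow> nat \<Rightarrow> 'v cpoly \<Rightarrow> ('v \<Rightarrow> complex) set" where
  "Sigma_locus X a F = {p \<in> dual_space X.
    \<forall>vs. set vs \<subseteq> X \<and> length vs \<le> a \<longrightarrow> cpoly_eval p (partial_derivs vs F) = 0}"

definition zariski_closed :: "'v set \<Rightarrow> ('v \<Rightarrow> complex) set \<Rightarrow> bool" where
  "zariski_closed X Z \<longleftrightarrow>
    (\<exists>S\<subseteq>polys X. Z = {p \<in> dual_space X. \<forall>f\<in>S. cpoly_eval p f = 0})"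

definition zariski_irreducible :: "'v set \<Rightarrow> ('v \<Rightarrow> complex) set \<Rightarrow> bool" where
  "zariski_irreducible X Z \<longleftrightarrow> zariski_closed X Z \<and> Z \<noteq> {} \<and>
    (\<forall>A B. zariski_closed X A \<and> zariski_closed X B \<and> Z = A \<union> B \<longrightarrow> Z = A \<or> Z = B)"

text \<open>
  Krull dimension in the Zariski topology: the supremum of the lengths \<open>n\<close> of chains
  \<open>Z\<^sub>0 \<subset> \<dots> \<subset> Z\<^sub>n\<close> of irreducible closed subsets of an algebraic set \<open>A\<close>. (The empty set gets
  dimension 0; \<^const>\<open>Sigma_locus\<close> is nonempty in the range of interest, as it contains the
  origin if \<open>a < d\<close>.)
\<close>

definition alg_dim :: "'v set \<Rightarrow> ('v \<Rightarrow> complex) set \<Rightarrow> enat" where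
  "alg_dim X A = Sup {enat n | n. \<exists>Z. (\<forall>i\<le>n. zariski_irreducible X (Z i) \<and> Z i \<subseteq> A)
    \<and> (\<forall>i<n. Z i \<subset> Z (Suc i))}"

end

theory Submission
  imports Defs "HOL-Library.FuncSet"
begin

text \<open>
  Write \<open>N(F) = dim Derivs(F)\<^bsub>d-a\<^esub> + dim \<Sigma>\<^sub>a(F)\<close>. The equalities follow from the chain
  \<open>\<Sum> rk(F\<^sub>i) = \<Sum> N(F\<^sub>i) \<le> N(F) \<le> rk(F) \<le> \<Sum> rk(F\<^sub>i)\<close>, in which the last inequality is the
  subadditivity of the rank and the first equality is the hypothesis.

  For \<open>\<Sum> N(F\<^sub>i) \<le> N(F)\<close>: a derivative of \<open>F\<close> of order \<open>a \<ge> 1\<close> in the variables of \<open>F\<^sub>i\<close> is the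
  same derivative of \<open>F\<^sub>i\<close>, and forms of positive degree in disjoint sets of variables are
  linearly independent (\<open>dim_derivs_sum_ge\<close>); moreover \<open>\<Sigma>\<^sub>a(F)\<close> contains the product of the
  \<open>\<Sigma>\<^sub>a(F\<^sub>i)\<close>, and the dimension is superadditive on products because products of irreducible
  closed sets are irreducible (\<open>alg_dim_product_ge\<close>).

  The bound \<open>N(F) \<le> rk(F)\<close> for concise \<open>F\<close> is due to Landsberg and Teitler
  (\<open>landsberg_teitler_bound\<close>). Let \<open>F = l\<^sub>1\<^sup>d + \<dots> + l\<^sub>r\<^sup>d\<close>, let \<open>c\<^sub>j\<close> be the vector of products of
  \<open>a\<close> coefficients of \<open>l\<^sub>j\<close>, and let \<open>(c\<^sub>b)\<close>, \<open>b \<in> B\<close>, be a basis of the span of all \<open>c\<^sub>j\<close>. The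
  derivatives of order \<open>a\<close> of \<open>F\<close> are, up to a constant, the entries of \<open>\<Sum> c\<^sub>j l\<^sub>j\<^bsup>d-a\<^esup>\<close>.
  So they span a space of dimension at most \<open>|B|\<close>, and on \<open>\<Sigma>\<^sub>a(F)\<close> the vanishing of this sum
  expresses each \<open>l\<^sub>b\<^bsup>d-a\<^esup>\<close> with \<open>b \<in> B\<close> linearly by the \<open>l\<^sub>t\<^bsup>d-a\<^esup>\<close> with \<open>t \<notin> B\<close>. By
  conciseness the \<open>l\<^sub>j\<close> span all linear forms; hence the polynomial functions on \<open>\<Sigma>\<^sub>a(F)\<close> are
  integral over the \<open>r - |B|\<close> functions \<open>l\<^sub>t\<close>, and \<open>dim \<Sigma>\<^sub>a(F) \<le> r - |B|\<close>.

  The last step is a growth estimate (\<open>alg_dim_le_card\<close>). A chain of irreducible closed sets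
  \<open>Z\<^sub>0 \<subset> \<dots> \<subset> Z\<^sub>n\<close> provides \<open>n\<close> algebraically independent functions on \<open>Z\<^sub>n\<close>, so that polynomials
  of degree \<open>O(M)\<close> span at least \<open>(M + 1)\<^sup>n\<close> dimensions on \<open>Z\<^sub>n\<close>. Integrality bounds the
  same dimension by \<open>O(M\<^sup>s)\<close> where \<open>s\<close> is the number of the \<open>l\<^sub>t\<close>.

  Finally, if \<open>F\<close> is not concise, then some derivative of \<open>F\<close> in a direction \<open>p \<noteq> 0\<close>
  vanishes; this derivative splits into those of the \<open>F\<^sub>i\<close>, which therefore vanish as well,
  and then a power sum decomposition of an \<open>F\<^sub>i\<close> with \<open>p\<^sub>i \<noteq> 0\<close> can be rewritten in linear forms
  that vanish at \<open>p\<^sub>i\<close>, which contradicts the conciseness of \<open>F\<^sub>i\<close> (\<open>concise_dir_deriv\<close>, \<open>concise_sum\<close>).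
\<close>

section \<open>Polynomials\<close>

abbreviation single :: "'a \<Rightarrow> 'b \<Rightarrow> 'a \<Rightarrow>\<^sub>0 'b::zero" where "single \<equiv> Poly_Mapping.single"
abbreviation lookup :: "('a \<Rightarrow>\<^sub>0 'b::zero) \<Rightarrow> 'a \<Rightarrow> 'b" where "lookup \<equiv> Poly_Mapping.lookup"
abbreviation keys :: "('a \<Rightarrow>\<^sub>0 'b::zero) \<Rightarrow> 'a set" where "keys \<equiv> Poly_Mapping.keys"

text \<open>
  The variable \<open>v\<close> as a polynomial.
\<close>

definition var :: "'v \<Rightarrow> 'v cpoly" where
  "var v = single (single v 1) 1"

text \<open>
  The value of the monomial \<open>m\<close> at the point \<open>p\<close>.
\<close>

definition mon_eval :: "('v \<Rightarrow> complex) \<Rightarrow> ('v \<Rightarrow>\<^sub>0 nat) \<Rightarrow> complex" where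
  "mon_eval p m = (\<Prod>v\<in>keys m. p v ^ lookup m v)"

lemma poly_mapping_eq_sum: "p = (\<Sum>m\<in>keys p. single m (lookup p m))"
  by (rule poly_mapping_eqI)
    (simp add: lookup_sum lookup_single when_def in_keys_iff sum.delta)

lemma keys_add_nat: "keys (m + n) = keys m \<union> keys (n :: 'v \<Rightarrow>\<^sub>0 nat)"
  by (auto simp: in_keys_iff lookup_add)

lemma single_sum_eq_prod: "finite S \<Longrightarrow> single (\<Sum>i\<in>S. g i) (1::complex) = (\<Prod>i\<in>S. single (g i) 1)"
proof (induction S rule: finite_induct)
  case (insert x S)
  then show ?case
    using mult_single[of "g x" 1 "\<Sum>i\<in>S. g i" "1::complex"] by simp
qed simp

lemma single_single_eq_var_power: "single (single v n) 1 = var v ^ n"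
proof (induction n)
  case (Suc n)
  have "single v (Suc n) = single v 1 + single v n"
    by (simp flip: single_add)
  then have "single (single v (Suc n)) 1 = single (single v 1) 1 * single (single v n) (1::complex)"
    by (simp only: mult_single mult_1)
  then show ?case
    using Suc by (simp add: var_def)
qed simp

lemma single_eq_prod_var: "single m c = single 0 c * (\<Prod>v\<in>keys m. var v ^ lookup m v)"
proof -
  have "single m (1::complex) = (\<Prod>v\<in>keys m. single (single v (lookup m v)) 1)"
    by (subst poly_mapping_eq_sum[of m], subst single_sum_eq_prod) auto
  then show ?thesis
    using mult_single[of 0 c m 1] by (simp add: single_single_eq_var_power)
qed

text \<open>
  Two induction principles for polynomials in the variables \<open>X\<close>: by monomials for additive
  statements, and by the ring operations for multiplicative ones.
\<close>

lemma polys_monomial_induct [consumes 1, case_names monomial add]: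
  assumes "p \<in> polys X"
    and monomial: "\<And>m c. keys m \<subseteq> X \<Longrightarrow> P (single m c)"
    and add: "\<And>p q. P p \<Longrightarrow> P q \<Longrightarrow> P (p + q)"
  shows "P p"
proof -
  have "P (\<Sum>m\<in>S. single m (lookup p m))" if "S \<subseteq> keys p" for S
    using finite_subset[OF that finite_keys] that
  proof (induction S rule: finite_induct)
    case empty
    show ?case using monomial[of 0 0] by simp
  next
    case (insert m S)
    then show ?case using assms(1) by (auto simp: polys_def intro!: add monomial)
  qed
  from this[of "keys p"] show ?thesis by (simp flip: poly_mapping_eq_sum)
qed

lemma polys_induct [consumes 1, case_names const var add mult]:
  assumes "p \<in> polys X"
    and const: "\<And>c. P (single 0 c)"
    and var: "\<And>v. v \<in> X \<Longrightarrow> P (var v)"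
    and add: "\<And>p q. P p \<Longrightarrow> P q \<Longrightarrow> P (p + q)"
    and mult: "\<And>p q. P p \<Longrightarrow> P q \<Longrightarrow> P (p * q)"
  shows "P p"
  using assms(1)
proof (induction rule: polys_monomial_induct)
  case (monomial m c)
  have power: "P (q ^ n)" if "P q" for q n
    by (induction n) (use const[of 1] that mult in auto)
  have "P (\<Prod>v\<in>S. var v ^ lookup m v)" if "S \<subseteq> keys m" for S
    using finite_subset[OF that finite_keys] that
  proof (induction S rule: finite_induct)
    case empty
    show ?case using const[of 1] by simp
  next
    case (insert v S)
    then show ?case using monomial by (auto intro!: mult power var)
  qed
  then show ?case
    by (subst single_eq_prod_var) (auto intro!: mult const)
qed (rule add)

section \<open>Closure properties of polynomials and forms\<close>

lemma polys_UNIV [simp]: "p \<in> polys UNIV"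
  by (simp add: polys_def)

lemma polys_mono: "X \<subseteq> Y \<Longrightarrow> polys X \<subseteq> polys Y"
  by (auto simp: polys_def)

lemma polys_single: "keys m \<subseteq> X \<Longrightarrow> single m c \<in> polys X"
  by (auto simp: polys_def)

lemma polys_const [simp]: "single 0 c \<in> polys X"
  by (simp add: polys_single)

lemma polys_zero [simp]: "0 \<in> polys X" and polys_one [simp]: "1 \<in> polys X"
  by (simp_all add: polys_def)

lemma polys_var: "v \<in> X \<Longrightarrow> var v \<in> polys X"
  by (simp add: polys_single var_def)

lemma polys_add: "p \<in> polys X \<Longrightarrow> q \<in> polys X \<Longrightarrow> p + q \<in> polys X"
  using keys_add[of p q] by (auto simp: polys_def)

lemma polys_uminus: "p \<in> polys X \<Longrightarrow> - p \<in> polys X"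
  by (auto simp: polys_def in_keys_iff)

lemma polys_diff: "p \<in> polys X \<Longrightarrow> q \<in> polys X \<Longrightarrow> p - q \<in> polys X"
  using polys_add[of p X "- q"] polys_uminus[of q X] by simp

lemma polys_mult: 
  assumes "p \<in> polys X" "q \<in> polys X"
  shows "p * q \<in> polys X"
  unfolding polys_def
proof (intro CollectI ballI)
  fix m assume "m \<in> keys (p * q)"
  then obtain a b where "m = a + b" "a \<in> keys p" "b \<in> keys q"
    using keys_mult by blast
  then show "keys m \<subseteq> X" using assms by (auto simp: polys_def keys_add_nat)
qed

lemma polys_power: "p \<in> polys X \<Longrightarrow> p ^ n \<in> polys X"
  by (induction n) (auto intro: polys_mult)

lemma sum_in_polys: "(\<And>i. i \<in> I \<Longrightarrow> f i \<in> polys X) \<Longrightarrow> (\<Sum>i\<in>I. f i) \<in> polys X"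
  by (induction I rule: infinite_finite_induct) (auto intro: polys_add)

lemma mdegree_add: "mdegree (m + n) = mdegree m + mdegree n"
proof -
  have "mdegree m = (\<Sum>v\<in>keys m \<union> keys n. lookup m v)" for m n :: "'a \<Rightarrow>\<^sub>0 nat"
    unfolding mdegree_def by (intro sum.mono_neutral_left) (auto simp: in_keys_iff)
  from this[of m n] this[of n m] show ?thesis
    by (simp add: mdegree_def keys_add_nat lookup_add sum.distrib Un_commute)
qed

lemma mdegree_single [simp]: "mdegree (single v n) = n"
  by (simp add: mdegree_def)

lemma mdegree_zero [simp]: "mdegree 0 = 0"
  by (simp add: mdegree_def)

lemma mdegree_eq_0_iff [simp]: "mdegree m = 0 \<longleftrightarrow> m = 0"
  by (auto simp: mdegree_def in_keys_iff intro!: poly_mapping_eqI)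

lemma single_var_eq_iff: "single v 1 = single w (1::nat) \<longleftrightarrow> v = w"
  by (metis lookup_single_eq lookup_single_not_eq zero_neq_one)

lemma mdegree_eq_1_iff: "mdegree m = 1 \<longleftrightarrow> (\<exists>v. m = single v 1)"
proof
  assume *: "mdegree m = 1"
  then have "m \<noteq> 0" by auto
  then obtain v where v: "v \<in> keys m"
    by (metis keys_eq_empty ex_in_conv)
  have "m = single v 1 + (m - single v 1)"
    using v by (intro poly_mapping_eqI) (auto simp: lookup_add lookup_minus lookup_single when_def in_keys_iff)
  then have "mdegree m = 1 + mdegree (m - single v 1)"
    by (metis mdegree_add mdegree_single)
  with * have "m - single v 1 = 0" by simp
  then show "\<exists>v. m = single v 1"
    using \<open>m = single v 1 + (m - single v 1)\<close> by auto
qed auto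

lemma forms_subset_polys: "forms X d \<subseteq> polys X"
  by (auto simp: forms_def)

lemma subspace_forms: "cpoly.subspace (forms X d)"
proof (rule cpoly.subspaceI)
  show "0 \<in> forms X d" by (simp add: forms_def)
next
  fix x y assume "x \<in> forms X d" "y \<in> forms X d"
  then show "x + y \<in> forms X d" using keys_add[of x y] by (auto simp: forms_def intro: polys_add)
next
  fix c x assume "x \<in> forms X d"
  moreover have "keys (cscale c x) \<subseteq> keys x"
    by (auto simp: cscale_def in_keys_iff map.rep_eq when_def split: if_splits)
  ultimately show "cscale c x \<in> forms X d"
    by (auto simp: forms_def polys_def)
qed

lemma forms_var: "v \<in> X \<Longrightarrow> var v \<in> forms X 1"
  by (simp add: forms_def polys_var) (simp add: var_def)

lemma lookup_cscale [simp]: "lookup (cscale c p) m = c * lookup p m"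
  by (simp add: cscale_def map.rep_eq when_def)

text \<open>The coefficient of the variable \<open>v\<close> in a linear form.\<close>

definition lcoeff :: "'v cpoly \<Rightarrow> 'v \<Rightarrow> complex" where
  "lcoeff l v = lookup l (single v 1)"

lemma linear_form_eq_sum:
  assumes "finite X" "l \<in> forms X 1"
  shows "l = (\<Sum>v\<in>X. cscale (lcoeff l v) (var v))"
proof (rule poly_mapping_eqI)
  fix m
  have *: "lookup (cscale (lcoeff l v) (var v)) m = (if m = single v 1 then lcoeff l v else 0)" for v
    by (auto simp: var_def lookup_single when_def)
  show "lookup l m = lookup (\<Sum>v\<in>X. cscale (lcoeff l v) (var v)) m"
  proof (cases "\<exists>v\<in>X. m = single v 1")
    case True
    then obtain v where v: "v \<in> X" "m = single v 1" by auto
    show ?thesis unfolding lookup_sum * unfolding v(2) single_var_eq_iff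
      using assms v by (simp add: lcoeff_def)
  next
    case False
    have "m \<notin> keys l"
    proof
      assume "m \<in> keys l"
      then have "mdegree m = 1" "keys m \<subseteq> X" using assms by (auto simp: forms_def polys_def)
      then show False using False unfolding mdegree_eq_1_iff by auto
    qed
    then show ?thesis unfolding lookup_sum * using False by (auto simp: in_keys_iff)
  qed
qed

section \<open>Evaluation\<close>

lemma cpoly_eval_alt: "cpoly_eval p f = (\<Sum>m\<in>keys f. lookup f m * mon_eval p m)"
  by (simp add: cpoly_eval_def mon_eval_def)

lemma mon_eval_add: "mon_eval p (m + n) = mon_eval p m * mon_eval p n"
proof -
  have "mon_eval p m = (\<Prod>v\<in>keys m \<union> keys n. p v ^ lookup m v)" for m n :: "'a \<Rightarrow>\<^sub>0 nat"
    unfolding mon_eval_def by (intro prod.mono_neutral_left) (auto simp: in_keys_iff)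
  from this[of m n] this[of n m] show ?thesis
    by (simp add: mon_eval_def keys_add_nat lookup_add power_add prod.distrib Un_commute)
qed

lemma eval_add [simp]: "cpoly_eval p (f + g) = cpoly_eval p f + cpoly_eval p g"
  unfolding cpoly_eval_alt
  by (rule setsum_keys_plus_distrib[where f = "\<lambda>m c. c * mon_eval p m"]) (auto simp: algebra_simps)

lemma eval_single: "cpoly_eval p (single m c) = c * mon_eval p m"
  by (simp add: cpoly_eval_alt)

lemma eval_zero [simp]: "cpoly_eval p 0 = 0"
  by (simp add: cpoly_eval_alt)

lemma eval_const [simp]: "cpoly_eval p (single 0 c) = c"
  by (simp add: eval_single mon_eval_def)

lemma eval_one [simp]: "cpoly_eval p 1 = 1"
  using eval_const[of p 1] by simp

lemma eval_var [simp]: "cpoly_eval p (var v) = p v"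
  by (simp add: eval_single var_def mon_eval_def)

lemma eval_mult [simp]: "cpoly_eval p (f * g) = cpoly_eval p f * cpoly_eval p g"
proof -
  have 1: "cpoly_eval p (single m c * g) = c * mon_eval p m * cpoly_eval p g" for m c
    using polys_UNIV[of g]
    by (induction g rule: polys_monomial_induct)
      (simp_all add: mult_single eval_single mon_eval_add algebra_simps)
  show ?thesis using polys_UNIV[of f]
    by (induction f rule: polys_monomial_induct) (simp_all add: 1 eval_single distrib_right)
qed

lemma eval_uminus [simp]: "cpoly_eval p (- f) = - cpoly_eval p f"
  using eval_add[of p f "- f"] by (simp add: minus_unique)

lemma eval_diff [simp]: "cpoly_eval p (f - g) = cpoly_eval p f - cpoly_eval p g"
  using eval_add[of p f "- g"] by simp

lemma eval_cscale [simp]: "cpoly_eval p (cscale c f) = c * cpoly_eval p f"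
  by (simp add: cscale_eq_mult)

lemma eval_sum [simp]: "cpoly_eval p (\<Sum>i\<in>I. f i) = (\<Sum>i\<in>I. cpoly_eval p (f i))"
  by (induction I rule: infinite_finite_induct) auto

lemma eval_power [simp]: "cpoly_eval p (f ^ n) = cpoly_eval p f ^ n"
  by (induction n) auto

lemma eval_cong:
  assumes "f \<in> polys X" "\<And>v. v \<in> X \<Longrightarrow> p v = q v"
  shows "cpoly_eval p f = cpoly_eval q f"
  using assms(1) by (induction rule: polys_induct) (use assms(2) in auto)

lemma eval_form_at_0:
  assumes "f \<in> forms X n" "n > 0"
  shows "cpoly_eval (\<lambda>_. 0) f = 0"
  unfolding cpoly_eval_alt
proof (intro sum.neutral ballI)
  fix m assume "m \<in> keys f"
  then have "m \<noteq> 0" using assms by (auto simp: forms_def)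
  then show "lookup f m * mon_eval (\<lambda>_. 0) m = 0"
    unfolding mon_eval_def by (auto intro!: bexI simp: in_keys_iff poly_mapping_eq_iff fun_eq_iff)
qed

section \<open>Partial derivatives\<close>

lemma partial_deriv_single: "partial_deriv v (single m c) = single (m - single v 1) (of_nat (lookup m v) * c)"
  by (simp add: partial_deriv_def)

lemma partial_deriv_add: "partial_deriv v (p + q) = partial_deriv v p + partial_deriv v q"
  unfolding partial_deriv_def
  by (rule setsum_keys_plus_distrib[where
        f = "\<lambda>m c. single (m - single v 1) (of_nat (lookup m v) * c)"])
    (auto simp: algebra_simps single_add)

lemma partial_deriv_zero [simp]: "partial_deriv v 0 = 0"
  by (simp add: partial_deriv_def)

lemma partial_deriv_mult:
  "partial_deriv v (p * q) = partial_deriv v p * q + p * partial_deriv v q"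
proof -
  have 0: "single (m + n - single v 1) (of_nat (lookup (m + n) v) * (c * d)) =
      single (m - single v 1 + n) (of_nat (lookup m v) * c * d) +
      single (m + (n - single v 1)) (c * (of_nat (lookup n v) * d))" 
      (is "?L = ?A + ?B") for m n :: "'a \<Rightarrow>\<^sub>0 nat" and c d :: complex
  proof -
    have A: "?A = single (m + n - single v 1) (of_nat (lookup m v) * c * d)"
    proof (cases "lookup m v = 0")
      case False
      then have "m - single v 1 + n = m + n - single v 1"
        by (intro poly_mapping_eqI) (auto simp: lookup_add lookup_minus lookup_single when_def)
      then show ?thesis by simp
    qed simp
    have B: "?B = single (m + n - single v 1) (c * (of_nat (lookup n v) * d))"
    proof (cases "lookup n v = 0")
      case False
      then have "m + (n - single v 1) = m + n - single v 1"
        by (intro poly_mapping_eqI) (auto simp: lookup_add lookup_minus lookup_single when_def)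
      then show ?thesis by simp
    qed simp
    show ?thesis unfolding A B by (simp add: lookup_add algebra_simps flip: single_add)
  qed
  have 1: "partial_deriv v (single m c * q) = partial_deriv v (single m c) * q + single m c * partial_deriv v q" for m c
    using polys_UNIV[of q]
  proof (induction q rule: polys_monomial_induct)
    case (monomial n d)
    then show ?case by (simp only: mult_single partial_deriv_single 0)
  next
    case (add p q)
    then show ?case by (simp add: partial_deriv_add distrib_left)
  qed
  show ?thesis using polys_UNIV[of p]
    by (induction p rule: polys_monomial_induct) (simp_all add: 1 partial_deriv_add distrib_right)
qed

lemma partial_deriv_const [simp]: "partial_deriv v (single 0 c) = 0"
  by (simp add: partial_deriv_single)

lemma partial_deriv_one [simp]: "partial_deriv v 1 = 0"
  using partial_deriv_const[of v 1] by simp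

lemma partial_deriv_cscale: "partial_deriv v (cscale c p) = cscale c (partial_deriv v p)"
  by (simp add: cscale_eq_mult partial_deriv_mult)

lemma partial_deriv_sum: "partial_deriv v (\<Sum>i\<in>I. f i) = (\<Sum>i\<in>I. partial_deriv v (f i))"
  by (induction I rule: infinite_finite_induct) (auto simp: partial_deriv_add)

lemma partial_deriv_polys:
  assumes "p \<in> polys X"
  shows "partial_deriv v p \<in> polys X"
  using assms
proof (induction rule: polys_monomial_induct)
  case (monomial m c)
  have "keys (m - single v 1) \<subseteq> keys m" by (auto simp: in_keys_iff lookup_minus)
  with monomial show ?case unfolding partial_deriv_single by (intro polys_single) auto
qed (auto simp: partial_deriv_add intro: polys_add)

lemma partial_deriv_eq_0:
  assumes "p \<in> polys X" "v \<notin> X"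
  shows "partial_deriv v p = 0"
  using assms(1) 
proof (induction rule: polys_monomial_induct)
  case (monomial m c)
  then have "lookup m v = 0" using assms(2) by (auto simp: in_keys_iff)
  then show ?case by (simp add: partial_deriv_single)
qed (auto simp: partial_deriv_add)

lemma partial_deriv_forms:
  assumes "p \<in> forms X d"
  shows "partial_deriv v p \<in> forms X (d - 1)"
proof -
  have "single (m - single v 1) (of_nat (lookup m v) * lookup p m) \<in> forms X (d - 1)"
    if "m \<in> keys p" for m
  proof (cases "lookup m v = 0")
    case True
    then show ?thesis using cpoly.subspace_0[OF subspace_forms] by simp
  next
    case False
    then have "m = single v 1 + (m - single v 1)"
      by (intro poly_mapping_eqI) (auto simp: lookup_add lookup_minus lookup_single when_def)
    then have "mdegree m = 1 + mdegree (m - single v 1)"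
      by (metis mdegree_add mdegree_single)
    moreover have "mdegree m = d" "keys m \<subseteq> X" using that assms by (auto simp: forms_def polys_def)
    moreover have "keys (m - single v 1) \<subseteq> keys m" by (auto simp: in_keys_iff lookup_minus)
    ultimately show ?thesis
      unfolding forms_def by (auto intro!: polys_single)
  qed
  then show ?thesis unfolding partial_deriv_def
    by (intro cpoly.subspace_sum[OF subspace_forms])
qed

lemma partial_deriv_linear:
  assumes "l \<in> forms X 1"
  shows "partial_deriv v l = single 0 (lcoeff l v)"
proof -
  have "single (m - single v 1) (of_nat (lookup m v) * lookup l m) =
      (if m = single v 1 then single 0 (lcoeff l v) else 0)" if "m \<in> keys l" for m
  proof -
    have "mdegree m = 1" using assms that by (auto simp: forms_def)
    then obtain w where m: "m = single w 1" unfolding mdegree_eq_1_iff by blast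
    show ?thesis
    proof (cases "w = v")
      case True
      then show ?thesis using m by (simp add: lcoeff_def)
    next
      case False
      then show ?thesis using m unfolding m single_var_eq_iff by (simp add: lookup_single)
    qed
  qed
  then have "partial_deriv v l = (\<Sum>m\<in>keys l. if m = single v 1 then single 0 (lcoeff l v) else 0)"
    unfolding partial_deriv_def by (rule sum.cong[OF refl])
  also have "\<dots> = single 0 (lcoeff l v)"
    by (simp add: lcoeff_def in_keys_iff)
  finally show ?thesis .
qed

lemma partial_deriv_power:
  assumes "l \<in> forms X 1"
  shows "partial_deriv v (l ^ n) = cscale (of_nat n * lcoeff l v) (l ^ (n - 1))"
proof (induction n)
  case (Suc n)
  have *: "l * cscale (of_nat n * lcoeff l v) (l ^ (n - 1)) = cscale (of_nat n * lcoeff l v) (l ^ n)"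
    by (cases n) (simp_all add: cscale_eq_mult mult_ac)
  show ?case
    using * by (simp add: partial_deriv_mult Suc partial_deriv_linear[OF assms] distrib_right
        cpoly.scale_left_distrib flip: cscale_eq_mult)
qed (use partial_deriv_const[of v 1] in simp)

lemma partial_derivs_Nil [simp]: "partial_derivs [] p = p"
  and partial_derivs_Cons: "partial_derivs (v # vs) p = partial_derivs vs (partial_deriv v p)"
  by (simp_all add: partial_derivs_def)

lemma partial_derivs_sum: "partial_derivs vs (\<Sum>i\<in>I. f i) = (\<Sum>i\<in>I. partial_derivs vs (f i))"
  by (induction vs arbitrary: f) (simp_all add: partial_derivs_Cons partial_deriv_sum)

lemma partial_derivs_cscale: "partial_derivs vs (cscale c p) = cscale c (partial_derivs vs p)"
  by (induction vs arbitrary: p) (simp_all add: partial_derivs_Cons partial_deriv_cscale)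

lemma partial_derivs_zero [simp]: "partial_derivs vs 0 = 0"
  by (induction vs) (simp_all add: partial_derivs_Cons)

lemma partial_derivs_forms:
  "p \<in> forms X d \<Longrightarrow> partial_derivs vs p \<in> forms X (d - length vs)"
proof (induction vs arbitrary: p d)
  case (Cons v vs)
  from Cons.IH[OF partial_deriv_forms[OF Cons.prems]] show ?case
    by (simp add: partial_derivs_Cons)
qed simp

lemma partial_derivs_polys: "p \<in> polys X \<Longrightarrow> partial_derivs vs p \<in> polys X"
  by (induction vs arbitrary: p) (simp_all add: partial_derivs_Cons partial_deriv_polys)

lemma partial_derivs_eq_0:
  "p \<in> polys X \<Longrightarrow> \<not> set vs \<subseteq> X \<Longrightarrow> partial_derivs vs p = 0"
proof (induction vs arbitrary: p)
  case (Cons v vs)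
  show ?case
  proof (cases "v \<in> X")
    case True
    with Cons show ?thesis by (auto simp: partial_derivs_Cons partial_deriv_polys)
  next
    case False
    then show ?thesis using partial_deriv_eq_0[OF Cons.prems(1)] by (simp add: partial_derivs_Cons)
  qed
qed simp

text \<open>
  The integer factor is the falling factorial \<open>n (n - 1) \<dots> (n - k + 1)\<close> with \<open>k\<close> the order
  of the derivative. If \<open>k > n\<close>, it is 0 since it contains the factor \<open>n - n\<close>.
\<close>

lemma partial_derivs_power:
  assumes "l \<in> forms X 1"
  shows "partial_derivs vs (l ^ n) =
    cscale (of_nat (\<Prod>i<length vs. n - i) * prod_list (map (lcoeff l) vs)) (l ^ (n - length vs))"
proof (induction vs arbitrary: n)
  case (Cons v vs)
  have "(\<Prod>i<Suc k. n - i) = n * (\<Prod>i<k. n - 1 - i)" for k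
    by (subst prod.lessThan_Suc_shift) simp
  then show ?case
    using Cons[of "n - 1"]
    by (simp add: partial_derivs_Cons partial_deriv_power[OF assms] partial_derivs_cscale mult_ac
        del: prod.lessThan_Suc)
qed simp

section \<open>Zariski closed sets and their products\<close>

text \<open>
  For disjoint \<open>X\<close> and \<open>Y\<close>, the dual space of \<open>X \<union> Y\<close> is the product of those of \<open>X\<close> and
  \<open>Y\<close>: the point with the components \<open>z\<close> and \<open>w\<close> is \<open>glue X z w\<close>. Only the values of \<open>z\<close> on \<open>X\<close> and
  those of \<open>w\<close> outside of \<open>X\<close> matter.
\<close>

definition glue :: "'v set \<Rightarrow> ('v \<Rightarrow> complex) \<Rightarrow> ('v \<Rightarrow> complex) \<Rightarrow> 'v \<Rightarrow> complex" where
  "glue X z w = (\<lambda>v. if v \<in> X then z v else w v)"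

text \<open>
  The component of \<open>p\<close> over \<open>X\<close>, extended by 0 to the other variables.
\<close>

definition restr :: "'v set \<Rightarrow> ('v \<Rightarrow> complex) \<Rightarrow> 'v \<Rightarrow> complex" where
  "restr X p = (\<lambda>v. if v \<in> X then p v else 0)"

text \<open>
  The product of a subset \<open>A\<close> of the dual space of \<open>X\<close> and a subset \<open>B\<close> of that of \<open>Y\<close>, as a subset
  of the dual space of \<open>X \<union> Y\<close>.
\<close>

definition dprod :: "'v set \<Rightarrow> ('v \<Rightarrow> complex) set \<Rightarrow> 'v set \<Rightarrow> ('v \<Rightarrow> complex) set \<Rightarrow> ('v \<Rightarrow> complex) set" where
  "dprod X A Y B = {r \<in> dual_space (X \<union> Y). restr X r \<in> A \<and> restr Y r \<in> B}"

lemma restr_in_dual_space [simp]: "restr X p \<in> dual_space X"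
  by (simp add: restr_def dual_space_def)

lemma glue_in_dual_space: "w \<in> dual_space Y \<Longrightarrow> glue X z w \<in> dual_space (X \<union> Y)"
  by (auto simp: glue_def dual_space_def)

lemma restr_glue1: "z \<in> dual_space X \<Longrightarrow> restr X (glue X z w) = z"
  by (auto simp: restr_def glue_def dual_space_def)

lemma restr_glue2: "w \<in> dual_space Y \<Longrightarrow> X \<inter> Y = {} \<Longrightarrow> restr Y (glue X z w) = w"
  by (auto simp: restr_def glue_def dual_space_def fun_eq_iff)

lemma glue_restr: "r \<in> dual_space (X \<union> Y) \<Longrightarrow> X \<inter> Y = {} \<Longrightarrow> glue X (restr X r) (restr Y r) = r"
  by (auto simp: restr_def glue_def dual_space_def fun_eq_iff)

lemma eval_restr: "f \<in> polys X \<Longrightarrow> cpoly_eval (restr X p) f = cpoly_eval p f"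
  by (rule eval_cong) (auto simp: restr_def)

lemma zariski_closedI:
  assumes "S \<subseteq> polys X" "Z = {p \<in> dual_space X. \<forall>f\<in>S. cpoly_eval p f = 0}"
  shows "zariski_closed X Z"
  using assms by (auto simp: zariski_closed_def)

lemma zariski_closedE:
  assumes "zariski_closed X Z"
  obtains S where "S \<subseteq> polys X" "Z = {p \<in> dual_space X. \<forall>f\<in>S. cpoly_eval p f = 0}"
  using assms by (auto simp: zariski_closed_def)

lemma zariski_closed_subset: "zariski_closed X Z \<Longrightarrow> Z \<subseteq> dual_space X"
  by (auto simp: zariski_closed_def)

lemma zariski_closed_Int:
  assumes "zariski_closed X A" "zariski_closed X B"
  shows "zariski_closed X (A \<inter> B)"
proof -
  obtain S where S: "S \<subseteq> polys X" "A = {p \<in> dual_space X. \<forall>f\<in>S. cpoly_eval p f = 0}"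
    using assms(1) by (rule zariski_closedE)
  obtain T where T: "T \<subseteq> polys X" "B = {p \<in> dual_space X. \<forall>f\<in>T. cpoly_eval p f = 0}"
    using assms(2) by (rule zariski_closedE)
  show ?thesis using S T by (intro zariski_closedI[of "S \<union> T"]) auto
qed

lemma zariski_closed_INT:
  assumes "\<And>i. i \<in> I \<Longrightarrow> zariski_closed X (A i)"
  shows "zariski_closed X {p \<in> dual_space X. \<forall>i\<in>I. p \<in> A i}"
proof -
  define S where "S i = (SOME S. S \<subseteq> polys X \<and> A i = {p \<in> dual_space X. \<forall>f\<in>S. cpoly_eval p f = 0})" for i
  have S: "S i \<subseteq> polys X \<and> A i = {p \<in> dual_space X. \<forall>f\<in>S i. cpoly_eval p f = 0}" if "i \<in> I" for i
    unfolding S_def by (rule someI_ex) (use assms[OF that] in \<open>simp add: zariski_closed_def\<close>)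
  show ?thesis
    by (rule zariski_closedI[of "\<Union>i\<in>I. S i"]) (use S in auto)
qed

lemma zariski_closed_zero_set:
  "f \<in> polys X \<Longrightarrow> zariski_closed X {p \<in> dual_space X. cpoly_eval p f = 0}"
  by (rule zariski_closedI[of "{f}"]) auto

text \<open>
  The coordinate ring of an irreducible set has no zero divisors.
\<close>

lemma zariski_irreducible_zero_product:
  assumes Z: "zariski_irreducible X Z" and "f \<in> polys X" "g \<in> polys X"
    and zero: "\<And>p. p \<in> Z \<Longrightarrow> cpoly_eval p f * cpoly_eval p g = 0"
    and f: "q \<in> Z" "cpoly_eval q f \<noteq> 0"
    and p: "p \<in> Z"
  shows "cpoly_eval p g = 0"
proof -
  let ?A = "Z \<inter> {p \<in> dual_space X. cpoly_eval p f = 0}"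
  let ?B = "Z \<inter> {p \<in> dual_space X. cpoly_eval p g = 0}"
  have closed: "zariski_closed X Z" using Z by (simp add: zariski_irreducible_def)
  have "zariski_closed X ?A" "zariski_closed X ?B"
    using closed assms(2,3) by (auto intro: zariski_closed_Int zariski_closed_zero_set)
  moreover have "Z = ?A \<union> ?B"
    using zero zariski_closed_subset[OF closed] by auto
  ultimately have "Z = ?A \<or> Z = ?B"
    using Z unfolding zariski_irreducible_def by blast
  with f p show ?thesis by auto
qed

lemma zariski_irreducible_singleton:
  assumes "p \<in> dual_space X"
  shows "zariski_irreducible X {p}"
  unfolding zariski_irreducible_def
proof (intro conjI allI impI)
  show "zariski_closed X {p}"
  proof (rule zariski_closedI[of "(\<lambda>v. var v - single 0 (p v)) ` X"])
    show "(\<lambda>v. var v - single 0 (p v)) ` X \<subseteq> polys X"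
      by (auto intro: polys_diff polys_var)
    show "{p} = {q \<in> dual_space X. \<forall>f\<in>(\<lambda>v. var v - single 0 (p v)) ` X. cpoly_eval q f = 0}"
      using assms by (auto simp: dual_space_def fun_eq_iff) metis
  qed
next
  fix A B assume "zariski_closed X A \<and> zariski_closed X B \<and> {p} = A \<union> B"
  then have "A \<subseteq> {p}" "B \<subseteq> {p}" "A \<noteq> {} \<or> B \<noteq> {}" by auto
  then show "{p} = A \<or> {p} = B" by blast
qed simp

text \<open>
  Substituting fixed values for the variables in \<open>X\<close> leaves a polynomial in the other variables.
\<close>

lemma partial_eval_snd:
  assumes "f \<in> polys (X \<union> Y)"
  shows "\<exists>g\<in>polys Y. \<forall>w. cpoly_eval w g = cpoly_eval (glue X z w) f"
  using assms
proof (induction rule: polys_induct)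
  case (const c)
  show ?case by (intro bexI[of _ "single 0 c"]) auto
next
  case (var v)
  show ?case
  proof (cases "v \<in> X")
    case True
    then show ?thesis by (intro bexI[of _ "single 0 (z v)"]) (auto simp: glue_def)
  next
    case False
    then show ?thesis using var
      by (intro bexI[of _ "var v"]) (auto simp: glue_def intro: polys_var)
  qed
next
  case (add p q)
  then obtain p' q' where "p' \<in> polys Y" "\<forall>w. cpoly_eval w p' = cpoly_eval (glue X z w) p"
    "q' \<in> polys Y" "\<forall>w. cpoly_eval w q' = cpoly_eval (glue X z w) q" by blast
  then show ?case by (intro bexI[of _ "p' + q'"]) (auto intro: polys_add)
next
  case (mult p q)
  then obtain p' q' where "p' \<in> polys Y" "\<forall>w. cpoly_eval w p' = cpoly_eval (glue X z w) p"
    "q' \<in> polys Y" "\<forall>w. cpoly_eval w q' = cpoly_eval (glue X z w) q" by blast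
  then show ?case by (intro bexI[of _ "p' * q'"]) (auto intro: polys_mult)
qed

lemma glue_swap: "X \<inter> Y = {} \<Longrightarrow> z \<in> dual_space X \<Longrightarrow> w \<in> dual_space Y \<Longrightarrow> glue X z w = glue Y w z"
  by (auto simp: glue_def dual_space_def fun_eq_iff)

lemma zariski_closed_slice_snd:
  assumes A: "zariski_closed (X \<union> Y) A" and z: "z \<in> dual_space X"
  shows "zariski_closed Y {w \<in> dual_space Y. glue X z w \<in> A}"
proof -
  obtain S where S: "S \<subseteq> polys (X \<union> Y)"
    "A = {p \<in> dual_space (X \<union> Y). \<forall>f\<in>S. cpoly_eval p f = 0}"
    using A by (rule zariski_closedE)
  have "\<exists>h. \<forall>f\<in>S. h f \<in> polys Y \<and> (\<forall>w. cpoly_eval w (h f) = cpoly_eval (glue X z w) f)"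
    using partial_eval_snd[of _ X Y z] S(1) by (intro bchoice) blast
  then obtain h where h: "\<And>f. f \<in> S \<Longrightarrow> h f \<in> polys Y"
    "\<And>f w. f \<in> S \<Longrightarrow> cpoly_eval w (h f) = cpoly_eval (glue X z w) f" by blast
  show ?thesis
  proof (rule zariski_closedI[of "h ` S"])
    show "h ` S \<subseteq> polys Y" using h by auto
    show "{w \<in> dual_space Y. glue X z w \<in> A} =
        {w \<in> dual_space Y. \<forall>f\<in>h ` S. cpoly_eval w f = 0}"
      using h S(2) glue_in_dual_space[of _ Y X z] by auto
  qed
qed

lemma zariski_closed_slice_fst:
  assumes A: "zariski_closed (X \<union> Y) A" and w: "w \<in> dual_space Y" and XY: "X \<inter> Y = {}"
  shows "zariski_closed X {z \<in> dual_space X. glue X z w \<in> A}"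
proof -
  have "{z \<in> dual_space X. glue X z w \<in> A} = {z \<in> dual_space X. glue Y w z \<in> A}"
    using glue_swap[OF XY _ w] by auto
  then show ?thesis
    using zariski_closed_slice_snd[of Y X A w] A w by (simp add: Un_commute)
qed

lemma zariski_closed_dprod:
  assumes "zariski_closed X A" "zariski_closed Y B"
  shows "zariski_closed (X \<union> Y) (dprod X A Y B)"
proof -
  obtain S where S: "S \<subseteq> polys X" "A = {p \<in> dual_space X. \<forall>f\<in>S. cpoly_eval p f = 0}"
    using assms(1) by (rule zariski_closedE)
  obtain T where T: "T \<subseteq> polys Y" "B = {p \<in> dual_space Y. \<forall>f\<in>T. cpoly_eval p f = 0}"
    using assms(2) by (rule zariski_closedE)
  show ?thesis
  proof (rule zariski_closedI[of "S \<union> T"])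
    show "S \<union> T \<subseteq> polys (X \<union> Y)"
      using S(1) T(1) polys_mono[of X "X \<union> Y"] polys_mono[of Y "X \<union> Y"] by auto
    have "cpoly_eval (restr X r) f = cpoly_eval r f" if "f \<in> S" for r f
      using that S(1) eval_restr by blast
    moreover have "cpoly_eval (restr Y r) f = cpoly_eval r f" if "f \<in> T" for r f
      using that T(1) eval_restr by blast
    ultimately show "dprod X A Y B = {p \<in> dual_space (X \<union> Y). \<forall>f\<in>S \<union> T. cpoly_eval p f = 0}"
      by (auto simp: dprod_def S(2) T(2))
  qed
qed

lemma glue_in_dprod:
  assumes "X \<inter> Y = {}" "A \<subseteq> dual_space X" "B \<subseteq> dual_space Y" "z \<in> A" "w \<in> B"
  shows "glue X z w \<in> dprod X A Y B"
proof -
  have "z \<in> dual_space X" "w \<in> dual_space Y" using assms by auto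
  then show ?thesis
    using assms by (simp add: dprod_def restr_glue1 restr_glue2 glue_in_dual_space)
qed

lemma dprod_eq_glue:
  assumes "X \<inter> Y = {}" "r \<in> dprod X A Y B"
  shows "r = glue X (restr X r) (restr Y r)" "restr X r \<in> A" "restr Y r \<in> B"
  using assms glue_restr[of r X Y] by (auto simp: dprod_def)

text \<open>
  If \<open>Z \<times> W = A \<union> B\<close> with closed \<open>A\<close> and \<open>B\<close>, then each slice \<open>{z} \<times> W\<close> lies in \<open>A\<close> or in
  \<open>B\<close> as \<open>W\<close> is irreducible. The sets of those \<open>z\<close> for which it lies in \<open>A\<close>, respectively \<open>B\<close>,
  are closed and cover \<open>Z\<close>, so one of them is \<open>Z\<close>.
\<close>

lemma zariski_irreducible_dprod:
  assumes Z: "zariski_irreducible X Z" and W: "zariski_irreducible Y W" and XY: "X \<inter> Y = {}"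
  shows "zariski_irreducible (X \<union> Y) (dprod X Z Y W)"
  unfolding zariski_irreducible_def
proof (intro conjI allI impI)
  have Zc: "zariski_closed X Z" and Wc: "zariski_closed Y W"
    using Z W by (auto simp: zariski_irreducible_def)
  then show "zariski_closed (X \<union> Y) (dprod X Z Y W)"
    by (rule zariski_closed_dprod)
  have Zd: "Z \<subseteq> dual_space X" and Wd: "W \<subseteq> dual_space Y"
    using Zc Wc by (auto dest: zariski_closed_subset)
  obtain z0 w0 where "z0 \<in> Z" "w0 \<in> W" using Z W by (auto simp: zariski_irreducible_def)
  then show "dprod X Z Y W \<noteq> {}" using glue_in_dprod[OF XY Zd Wd] by blast
  fix A B
  assume *: "zariski_closed (X \<union> Y) A \<and> zariski_closed (X \<union> Y) B \<and> dprod X Z Y W = A \<union> B"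
  define slice where "slice C z = W \<inter> {w \<in> dual_space Y. glue X z w \<in> C}" for C z
  define full where
    "full C = Z \<inter> {z \<in> dual_space X. \<forall>w\<in>W. z \<in> {z \<in> dual_space X. glue X z w \<in> C}}" for C
  have full_iff: "z \<in> full C \<longleftrightarrow> z \<in> Z \<and> slice C z = W" for z C
    using Zd Wd by (auto simp: full_def slice_def)
  have full_closed: "zariski_closed X (full C)" if "zariski_closed (X \<union> Y) C" for C
    unfolding full_def using Zc Wd that XY
    by (intro zariski_closed_Int zariski_closed_INT zariski_closed_slice_fst) auto
  have "z \<in> full A \<union> full B" if z: "z \<in> Z" for z
  proof -
    have "zariski_closed Y (slice A z)" "zariski_closed Y (slice B z)"
      unfolding slice_def using Wc * z Zd by (auto intro!: zariski_closed_Int zariski_closed_slice_snd)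
    moreover have "W = slice A z \<union> slice B z"
      using glue_in_dprod[OF XY Zd Wd z] * Wd by (auto simp: slice_def)
    ultimately have "slice A z = W \<or> slice B z = W"
      using W unfolding zariski_irreducible_def by blast
    then show ?thesis using z full_iff by auto
  qed
  moreover have "full A \<union> full B \<subseteq> Z" by (auto simp: full_def)
  ultimately have "Z = full A \<union> full B" by blast
  then have "Z = full A \<or> Z = full B"
    using Z full_closed * unfolding zariski_irreducible_def by blast
  moreover have "dprod X Z Y W \<subseteq> C" if "Z = full C" for C
  proof
    fix r assume r: "r \<in> dprod X Z Y W"
    note r' = dprod_eq_glue[OF XY r]
    have "restr X r \<in> full C" using r' that by auto
    then have "restr Y r \<in> slice C (restr X r)" using r' by (auto simp: full_iff)
    then show "r \<in> C" using r'(1) by (auto simp: slice_def)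
  qed
  ultimately show "dprod X Z Y W = A \<or> dprod X Z Y W = B" using * by blast
qed

text \<open>
  A chain \<open>Z\<^sub>0 \<subset> \<dots> \<subset> Z\<^sub>n\<close> of irreducible closed sets, of length \<open>n\<close>; the values of \<open>Z\<close> beyond
  \<open>n\<close> are irrelevant.
\<close>

definition irr_chain :: "'v set \<Rightarrow> (nat \<Rightarrow> ('v \<Rightarrow> complex) set) \<Rightarrow> nat \<Rightarrow> bool" where
  "irr_chain X Z n \<longleftrightarrow> (\<forall>i\<le>n. zariski_irreducible X (Z i)) \<and> (\<forall>i<n. Z i \<subset> Z (Suc i))"

lemma irr_chain_mono: "irr_chain X Z n \<Longrightarrow> i \<le> j \<Longrightarrow> j \<le> n \<Longrightarrow> Z i \<subseteq> Z j"
proof (induction j)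
  case (Suc j)
  show ?case
  proof (cases "i = Suc j")
    case False
    then have "Z i \<subseteq> Z j" using Suc by auto
    moreover have "Z j \<subset> Z (Suc j)" using Suc.prems by (auto simp: irr_chain_def)
    ultimately show ?thesis by auto
  qed auto
qed auto

lemma alg_dim_alt: "alg_dim X A = Sup {enat n | n. \<exists>Z. irr_chain X Z n \<and> Z n \<subseteq> A}"
proof -
  have "(\<forall>i\<le>n. zariski_irreducible X (Z i) \<and> Z i \<subseteq> A) \<and> (\<forall>i<n. Z i \<subset> Z (Suc i)) \<longleftrightarrow>
      irr_chain X Z n \<and> Z n \<subseteq> A" for Z n
    using irr_chain_mono[of X Z n _ n] by (fastforce simp: irr_chain_def)
  then show ?thesis unfolding alg_dim_def by simp
qed

lemma alg_dim_geI: "irr_chain X Z n \<Longrightarrow> Z n \<subseteq> A \<Longrightarrow> enat n \<le> alg_dim X A"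
  unfolding alg_dim_alt by (rule Sup_upper) auto

lemma alg_dim_leI:
  assumes "\<And>Z n. irr_chain X Z n \<Longrightarrow> Z n \<subseteq> A \<Longrightarrow> enat n \<le> c"
  shows "alg_dim X A \<le> c"
  unfolding alg_dim_alt by (rule Sup_least) (use assms in auto)

lemma alg_dim_mono: "A \<subseteq> B \<Longrightarrow> alg_dim X A \<le> alg_dim X B"
  by (rule alg_dim_leI) (auto intro: alg_dim_geI)

lemma enat_Sup_add_le:
  fixes S T :: "enat set"
  assumes "S \<noteq> {}" "T \<noteq> {}" "\<And>s t. s \<in> S \<Longrightarrow> t \<in> T \<Longrightarrow> s + t \<le> c"
  shows "Sup S + Sup T \<le> c"
proof (cases c)
  case (enat n)
  have "s \<le> enat n" if "s \<in> S" for s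
  proof -
    obtain t where "t \<in> T" using assms by auto
    with assms(3)[OF that this] enat show ?thesis by (metis add_increasing2 le_iff_add order_trans)
  qed
  then have S: "finite S" by (rule finite_enat_bounded)
  have "t \<le> enat n" if "t \<in> T" for t
  proof -
    obtain s where "s \<in> S" using assms by auto
    with assms(3)[OF this that] enat show ?thesis by (metis add.commute le_iff_add order_trans)
  qed
  then have T: "finite T" by (rule finite_enat_bounded)
  show ?thesis using S T assms Max_in[of S] Max_in[of T] by (simp add: Sup_enat_def)
qed simp

lemma alg_dim_nonempty:
  assumes "p \<in> A" "p \<in> dual_space X"
  shows "{enat n | n. \<exists>Z. irr_chain X Z n \<and> Z n \<subseteq> A} \<noteq> {}"
proof -
  have "irr_chain X (\<lambda>_. {p}) 0" using zariski_irreducible_singleton[OF assms(2)]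
    by (simp add: irr_chain_def)
  then show ?thesis using assms(1) by blast
qed

text \<open>
  The chains are traversed one after the other, so that the lengths add up.
\<close>

lemma irr_chain_dprod:
  assumes Z: "irr_chain X Z n" and W: "irr_chain Y W m" and XY: "X \<inter> Y = {}"
  defines "U \<equiv> \<lambda>i. if i \<le> n then dprod X (Z i) Y (W 0) else dprod X (Z n) Y (W (i - n))"
  shows "irr_chain (X \<union> Y) U (n + m)"
  unfolding irr_chain_def
proof (intro conjI allI impI)
  fix i assume "i \<le> n + m"
  then show "zariski_irreducible (X \<union> Y) (U i)"
    using Z W XY by (auto simp: U_def irr_chain_def intro!: zariski_irreducible_dprod)
next
  have Zd: "Z i \<subseteq> dual_space X" "Z i \<noteq> {}" if "i \<le> n" for i
    using Z that zariski_closed_subset by (auto simp: irr_chain_def zariski_irreducible_def)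
  have Wd: "W i \<subseteq> dual_space Y" "W i \<noteq> {}" if "i \<le> m" for i
    using W that zariski_closed_subset by (auto simp: irr_chain_def zariski_irreducible_def)
  have strict1: "dprod X A Y C \<subset> dprod X B Y C"
    if AB: "A \<subset> B" "B \<subseteq> dual_space X" "C \<subseteq> dual_space Y" and C: "C \<noteq> {}" for A B C
  proof -
    obtain z w where zw: "z \<in> B" "z \<notin> A" "w \<in> C" using AB C by auto
    then have "z \<in> dual_space X" using that by auto
    then have "glue X z w \<notin> dprod X A Y C" using zw by (simp add: dprod_def restr_glue1)
    moreover have "glue X z w \<in> dprod X B Y C" using that zw by (intro glue_in_dprod XY) auto
    ultimately show ?thesis using that by (auto simp: dprod_def)
  qed
  have strict2: "dprod X C Y A \<subset> dprod X C Y B"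
    if AB: "A \<subset> B" "B \<subseteq> dual_space Y" "C \<subseteq> dual_space X" and C: "C \<noteq> {}" for A B C
  proof -
    obtain z w where zw: "w \<in> B" "w \<notin> A" "z \<in> C" using AB C by auto
    then have "w \<in> dual_space Y" using that by auto
    then have "glue X z w \<notin> dprod X C Y A" using zw XY by (simp add: dprod_def restr_glue2)
    moreover have "glue X z w \<in> dprod X C Y B" using that zw by (intro glue_in_dprod XY) auto
    ultimately show ?thesis using that by (auto simp: dprod_def)
  qed
  fix i assume i: "i < n + m"
  consider "i < n" | "i = n" | "n < i" by linarith
  then show "U i \<subset> U (Suc i)"
  proof cases
    case 1
    then have "Z i \<subset> Z (Suc i)" using Z by (simp add: irr_chain_def)
    then show ?thesis using 1 strict1[of "Z i" "Z (Suc i)" "W 0"] Zd[of "Suc i"] Wd[of 0]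
      by (simp add: U_def)
  next
    case 2
    then have "W 0 \<subset> W (Suc 0)" using i W by (simp add: irr_chain_def)
    then show ?thesis using 2 i strict2[of "W 0" "W (Suc 0)" "Z n"] Zd[of n] Wd[of "Suc 0"]
      by (simp add: U_def)
  next
    case 3
    then have "W (i - n) \<subset> W (Suc (i - n))" using i W by (simp add: irr_chain_def)
    moreover have "Suc i - n = Suc (i - n)" using 3 by auto
    ultimately show ?thesis
      using 3 i strict2[of "W (i - n)" "W (Suc (i - n))" "Z n"] Zd[of n] Wd[of "Suc (i - n)"]
      by (simp add: U_def)
  qed
qed

text \<open>
  Nonemptiness is needed, since the empty set has dimension 0 but annihilates products.
\<close>

lemma alg_dim_dprod_ge:
  assumes XY: "X \<inter> Y = {}" and "z \<in> A" "z \<in> dual_space X" "w \<in> B" "w \<in> dual_space Y"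
  shows "alg_dim X A + alg_dim Y B \<le> alg_dim (X \<union> Y) (dprod X A Y B)"
  unfolding alg_dim_alt[of X A] alg_dim_alt[of Y B]
proof (rule enat_Sup_add_le; (intro alg_dim_nonempty)?)
  fix s t
  assume "s \<in> {enat n | n. \<exists>Z. irr_chain X Z n \<and> Z n \<subseteq> A}"
    and "t \<in> {enat n | n. \<exists>Z. irr_chain Y Z n \<and> Z n \<subseteq> B}"
  then obtain n m Z W where *: "s = enat n" "t = enat m" "irr_chain X Z n" "Z n \<subseteq> A"
    "irr_chain Y W m" "W m \<subseteq> B" by auto
  show "s + t \<le> alg_dim (X \<union> Y) (dprod X A Y B)"
    unfolding * plus_enat_simps
    by (rule alg_dim_geI[OF irr_chain_dprod[OF *(3,5) XY]])
      (use *(4,6) irr_chain_mono[OF *(3)] in \<open>auto simp: dprod_def\<close>)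
qed (use assms in auto)

lemma alg_dim_product_ge:
  assumes "finite I" "disjoint_family_on X I" "\<And>i. i \<in> I \<Longrightarrow> (\<lambda>_. 0) \<in> A i"
  shows "(\<Sum>i\<in>I. alg_dim (X i) (A i)) \<le>
    alg_dim (\<Union>i\<in>I. X i) {r \<in> dual_space (\<Union>i\<in>I. X i). \<forall>i\<in>I. restr (X i) r \<in> A i}"
  using assms
proof (induction I rule: finite_induct)
  case (insert j I)
  let ?Y = "\<Union>i\<in>I. X i"
  let ?B = "{r \<in> dual_space ?Y. \<forall>i\<in>I. restr (X i) r \<in> A i}"
  have disj: "X j \<inter> ?Y = {}"
    using insert.prems(1) insert.hyps(2) by (fastforce simp: disjoint_family_on_def)
  have "disjoint_family_on X I" using insert.prems(1) by (auto simp: disjoint_family_on_def)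
  then have "(\<Sum>i\<in>insert j I. alg_dim (X i) (A i)) \<le> alg_dim (X j) (A j) + alg_dim ?Y ?B"
    using insert by (simp add: add_left_mono)
  also have "\<dots> \<le> alg_dim (X j \<union> ?Y) (dprod (X j) (A j) ?Y ?B)"
    using insert.prems(2) by (intro alg_dim_dprod_ge[OF disj, of "\<lambda>_. 0" _ "\<lambda>_. 0"])
      (auto simp: dual_space_def restr_def)
  also have "\<dots> \<le> alg_dim (X j \<union> ?Y) {r \<in> dual_space (X j \<union> ?Y). \<forall>i\<in>insert j I. restr (X i) r \<in> A i}"
  proof (rule alg_dim_mono, rule subsetI)
    fix r assume r: "r \<in> dprod (X j) (A j) ?Y ?B"
    have "restr (X i) (restr ?Y r) = restr (X i) r" if "i \<in> I" for i
      using that by (auto simp: restr_def)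
    then show "r \<in> {r \<in> dual_space (X j \<union> ?Y). \<forall>i\<in>insert j I. restr (X i) r \<in> A i}"
      using r by (auto simp: dprod_def)
  qed
  finally show ?case by simp
qed simp

section \<open>Two facts from linear algebra\<close>

lemma nontrivial_relation:
  fixes A :: "'i \<Rightarrow> 'k \<Rightarrow> complex"
  assumes "finite K" "finite I" "card K < card I"
  shows "\<exists>u. (\<exists>i\<in>I. u i \<noteq> 0) \<and> (\<forall>k\<in>K. (\<Sum>i\<in>I. u i * A i k) = 0)"
  using assms
proof (induction K arbitrary: I A rule: finite_induct)
  case empty
  then obtain i where "i \<in> I" by fastforce
  then show ?case by (intro exI[of _ "\<lambda>_. 1"]) auto
next
  case (insert k K)
  show ?case
  proof (cases "\<forall>i\<in>I. A i k = 0")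
    case True
    have "card K < card I" using insert by simp
    from insert.IH[OF insert.prems(1) this, of A] True show ?thesis by auto
  next
    case False
    then obtain i0 where i0: "i0 \<in> I" "A i0 k \<noteq> 0" by auto
    define I' where "I' = I - {i0}"
    have I': "finite I'" "card K < card I'" "I = insert i0 I'" "i0 \<notin> I'"
      using insert i0 by (auto simp: I'_def)
    from insert.IH[OF I'(1,2), of "\<lambda>i k'. A i k' - A i k / A i0 k * A i0 k'"]
    obtain u where u: "\<exists>i\<in>I'. u i \<noteq> 0"
      "\<And>k'. k' \<in> K \<Longrightarrow> (\<Sum>i\<in>I'. u i * (A i k' - A i k / A i0 k * A i0 k')) = 0"
      by blast
    define w where "w = u(i0 := - (\<Sum>i\<in>I'. u i * A i k / A i0 k))"
    have w: "(\<Sum>i\<in>I. w i * A i k') = (\<Sum>i\<in>I'. u i * (A i k' - A i k / A i0 k * A i0 k'))" for k'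
    proof -
      have "(\<Sum>i\<in>I'. w i * A i k') = (\<Sum>i\<in>I'. u i * A i k')"
        using I'(4) by (intro sum.cong) (auto simp: w_def)
      then have "(\<Sum>i\<in>I. w i * A i k') =
          (\<Sum>i\<in>I'. u i * A i k') - (\<Sum>i\<in>I'. u i * A i k / A i0 k) * A i0 k'"
        using I' by (simp add: w_def)
      then show ?thesis
        by (simp add: sum_distrib_right sum_subtractf right_diff_distrib mult.assoc)
    qed
    show ?thesis
    proof (intro exI[of _ w] conjI ballI)
      show "\<exists>i\<in>I. w i \<noteq> 0" using u(1) I' by (auto simp: w_def)
      fix k' assume "k' \<in> insert k K"
      then show "(\<Sum>i\<in>I. w i * A i k') = 0"
        unfolding w using u(2) i0(2) by auto
    qed
  qed
qed

text \<open>
  A basis of the span of a finite family of vectors \<open>c\<^sub>j\<close>, as a set \<open>B\<close> of indices. Repeated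
  vectors are thereby treated correctly.
\<close>

lemma maximal_independent_subfamily:
  fixes c :: "'j \<Rightarrow> 'k \<Rightarrow> complex"
  assumes "finite J"
  obtains B \<gamma> where "B \<subseteq> J"
    "\<And>u. (\<And>k. (\<Sum>b\<in>B. u b * c b k) = 0) \<Longrightarrow> \<forall>b\<in>B. u b = 0"
    "\<And>j k. j \<in> J \<Longrightarrow> c j k = (\<Sum>b\<in>B. \<gamma> j b * c b k)"
proof -
  define indep where "indep B \<longleftrightarrow> (\<forall>u. (\<forall>k. (\<Sum>b\<in>B. u b * c b k) = 0) \<longrightarrow> (\<forall>b\<in>B. u b = 0))" for B
  let ?\<B> = "{B. B \<subseteq> J \<and> indep B}"
  have "finite ?\<B>" by (rule finite_subset[of _ "Pow J"]) (use assms in auto)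
  moreover have "{} \<in> ?\<B>" by (auto simp: indep_def)
  ultimately have "\<exists>B\<in>?\<B>. \<forall>B'\<in>?\<B>. B \<subseteq> B' \<longrightarrow> B = B'"
    by (intro finite_has_maximal) auto
  then obtain B where B: "B \<subseteq> J" "indep B" and max: "\<forall>B'\<in>?\<B>. B \<subseteq> B' \<longrightarrow> B = B'"
    by auto
  have fin: "finite B" using B(1) assms by (rule finite_subset)
  have "\<exists>\<gamma>. \<forall>k. c j k = (\<Sum>b\<in>B. \<gamma> b * c b k)" if j: "j \<in> J" for j
  proof (cases "j \<in> B")
    case True
    have "(\<Sum>b\<in>B. (if b = j then 1 else 0) * c b k) = (\<Sum>b\<in>B. if b = j then c b k else 0)" for k
      by (intro sum.cong) auto
    then show ?thesis using True fin by (intro exI[of _ "\<lambda>b. if b = j then 1 else 0"]) simp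
  next
    case False
    have "\<not> indep (insert j B)" using bspec[OF max, of "insert j B"] j B(1) False by auto
    then obtain u where u: "\<And>k. (\<Sum>b\<in>insert j B. u b * c b k) = 0" "\<exists>b\<in>insert j B. u b \<noteq> 0"
      by (auto simp: indep_def)
    have u': "u j * c j k + (\<Sum>b\<in>B. u b * c b k) = 0" for k using u(1)[of k] False fin by simp
    have "u j \<noteq> 0"
    proof
      assume "u j = 0"
      then have "\<forall>b\<in>B. u b = 0" using u' B(2) by (simp add: indep_def)
      with u(2) \<open>u j = 0\<close> show False by auto
    qed
    then have "c j k = (\<Sum>b\<in>B. (- u b / u j) * c b k)" for k
    proof -
      have "c j k = - (\<Sum>b\<in>B. u b * c b k) / u j"
        using u'[of k] \<open>u j \<noteq> 0\<close> by (simp add: field_simps eq_neg_iff_add_eq_0)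
      then show ?thesis by (simp add: sum_negf sum_divide_distrib)
    qed
    then show ?thesis by (intro exI[of _ "\<lambda>b. - u b / u j"]) blast
  qed
  then have "\<forall>j\<in>J. \<exists>\<gamma>. \<forall>k. c j k = (\<Sum>b\<in>B. \<gamma> b * c b k)" by blast
  from bchoice[OF this] obtain \<gamma> where "\<forall>j\<in>J. \<forall>k. c j k = (\<Sum>b\<in>B. \<gamma> j b * c b k)" by blast
  with B that show thesis by (auto simp: indep_def)
qed

section \<open>An upper bound for the dimension\<close>

text \<open>
  The total degree is at most \<open>D\<close>.
\<close>

definition deg_le :: "'v cpoly \<Rightarrow> nat \<Rightarrow> bool" where
  "deg_le p D \<longleftrightarrow> (\<forall>m\<in>keys p. mdegree m \<le> D)"

lemma deg_le_exists: "\<exists>D. deg_le p D"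
proof
  show "deg_le p (\<Sum>m\<in>keys p. mdegree m)"
    by (auto simp: deg_le_def intro: member_le_sum)
qed

lemma deg_le_one: "deg_le 1 D"
  by (simp add: deg_le_def)

lemma deg_le_mono: "deg_le p D \<Longrightarrow> D \<le> E \<Longrightarrow> deg_le p E"
  by (auto simp: deg_le_def)

lemma deg_le_mult: "deg_le p D \<Longrightarrow> deg_le q E \<Longrightarrow> deg_le (p * q) (D + E)"
  using keys_mult[of p q] by (fastforce simp: deg_le_def mdegree_add intro: add_mono)

lemma deg_le_power: "deg_le p D \<Longrightarrow> deg_le (p ^ n) (n * D)"
  by (induction n) (auto simp: deg_le_one deg_le_mult)

text \<open>
  Exponent vectors with \<open>n\<close> entries between 0 and \<open>M\<close>. Lists are used so that one index type
  serves for all \<open>n\<close> in an induction.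
\<close>

definition exps :: "nat \<Rightarrow> nat \<Rightarrow> nat list set" where
  "exps n M = {xs. set xs \<subseteq> {..M} \<and> length xs = n}"

lemma finite_exps: "finite (exps n M)"
  unfolding exps_def by (rule finite_lists_length_eq) simp

lemma card_exps: "card (exps n M) = (M + 1) ^ n"
  unfolding exps_def by (subst card_lists_length_eq) simp_all

lemma sum_exps_Suc: "(\<Sum>\<alpha>\<in>exps (Suc n) M. h \<alpha>) = (\<Sum>t\<le>M. \<Sum>\<alpha>\<in>exps n M. h (t # \<alpha>))"
proof -
  have "(\<Sum>t\<le>M. \<Sum>\<alpha>\<in>exps n M. h (t # \<alpha>)) = (\<Sum>(t, \<alpha>)\<in>{..M} \<times> exps n M. h (t # \<alpha>))"
    by (simp add: sum.cartesian_product)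
  also have "\<dots> = (\<Sum>\<alpha>\<in>exps (Suc n) M. h \<alpha>)"
    by (rule sum.reindex_bij_witness[of _ "\<lambda>\<alpha>. (hd \<alpha>, tl \<alpha>)" "\<lambda>(t, \<alpha>). t # \<alpha>"])
      (auto simp: exps_def length_Suc_conv)
  finally show ?thesis by simp
qed

lemma irr_chain_separating_poly:
  assumes "irr_chain X Z (Suc n)"
  obtains f q where "f \<in> polys X" "\<And>p. p \<in> Z n \<Longrightarrow> cpoly_eval p f = 0"
    "q \<in> Z (Suc n)" "cpoly_eval q f \<noteq> 0"
proof -
  have "Z n \<subset> Z (Suc n)" "zariski_closed X (Z n)" "zariski_closed X (Z (Suc n))"
    using assms by (auto simp: irr_chain_def zariski_irreducible_def)
  then obtain q where q: "q \<in> Z (Suc n)" "q \<notin> Z n" "q \<in> dual_space X"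
    using zariski_closed_subset by blast
  obtain S where "S \<subseteq> polys X" "Z n = {p \<in> dual_space X. \<forall>f\<in>S. cpoly_eval p f = 0}"
    using \<open>zariski_closed X (Z n)\<close> by (rule zariski_closedE)
  with q that show ?thesis by auto
qed

text \<open>
  The family consists of the monomials \<open>f\<^sub>1\<^bsup>\<alpha>1\<^esup> \<dots> f\<^sub>n\<^bsup>\<alpha>n\<^esup>\<close> with exponents at most \<open>M\<close>, where \<open>f\<^sub>j\<close> vanishes on
  \<open>Z\<^sub>j\<^sub>-\<^sub>1\<close> but not on \<open>Z\<^sub>j\<close>. A linear relation on \<open>Z\<^sub>n\<close> can be divided by the lowest power of \<open>f\<^sub>n\<close>
  that occurs in it, as \<open>Z\<^sub>n\<close> is irreducible; restricted to \<open>Z\<^sub>n\<^sub>-\<^sub>1\<close>, it then becomes a relation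
  between the monomials in \<open>f\<^sub>1, \<dots>, f\<^sub>n\<^sub>-\<^sub>1\<close>. The degree bound \<open>D * M\<close> is linear in \<open>M\<close>.
\<close>

lemma irr_chain_independent_family:
  assumes "irr_chain X Z n"
  shows "\<exists>D. \<forall>M. \<exists>g. (\<forall>\<alpha>\<in>exps n M. g \<alpha> \<in> polys X \<and> deg_le (g \<alpha>) (D * M)) \<and>
    (\<forall>u. (\<forall>p\<in>Z n. (\<Sum>\<alpha>\<in>exps n M. u \<alpha> * cpoly_eval p (g \<alpha>)) = 0) \<longrightarrow> (\<forall>\<alpha>\<in>exps n M. u \<alpha> = 0))"
  using assms
proof (induction n)
  case 0
  have exps: "exps 0 M = {[]}" for M by (auto simp: exps_def)
  have "Z 0 \<noteq> {}" using 0 by (auto simp: irr_chain_def zariski_irreducible_def)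
  then show ?case unfolding exps
    by (intro exI[of _ 0] allI exI[of _ "\<lambda>_. 1"]) (auto simp: deg_le_one)
next
  case (Suc n)
  have "irr_chain X Z n" using Suc.prems by (auto simp: irr_chain_def)
  from Suc.IH[OF this] obtain D where D: "\<And>M. \<exists>g. (\<forall>\<alpha>\<in>exps n M. g \<alpha> \<in> polys X \<and> deg_le (g \<alpha>) (D * M)) \<and>
    (\<forall>u. (\<forall>p\<in>Z n. (\<Sum>\<alpha>\<in>exps n M. u \<alpha> * cpoly_eval p (g \<alpha>)) = 0) \<longrightarrow> (\<forall>\<alpha>\<in>exps n M. u \<alpha> = 0))"
    by blast
  obtain f q where f: "f \<in> polys X" "\<And>p. p \<in> Z n \<Longrightarrow> cpoly_eval p f = 0"
    "q \<in> Z (Suc n)" "cpoly_eval q f \<noteq> 0" using irr_chain_separating_poly[OF Suc.prems] by metis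
  obtain E where E: "deg_le f E" using deg_le_exists by blast
  have irr: "zariski_irreducible X (Z (Suc n))" and sub: "Z n \<subseteq> Z (Suc n)"
    using Suc.prems by (auto simp: irr_chain_def)
  show ?case
  proof (intro exI[of _ "E + D"] allI)
    fix M
    obtain g where g: "\<And>\<alpha>. \<alpha> \<in> exps n M \<Longrightarrow> g \<alpha> \<in> polys X" "\<And>\<alpha>. \<alpha> \<in> exps n M \<Longrightarrow> deg_le (g \<alpha>) (D * M)"
      "\<And>u. (\<forall>p\<in>Z n. (\<Sum>\<alpha>\<in>exps n M. u \<alpha> * cpoly_eval p (g \<alpha>)) = 0) \<Longrightarrow> (\<forall>\<alpha>\<in>exps n M. u \<alpha> = 0)"
      using D[of M] by blast
    define h where "h \<alpha> = f ^ hd \<alpha> * g (tl \<alpha>)" for \<alpha>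
    have h: "h \<alpha> \<in> polys X \<and> deg_le (h \<alpha>) ((E + D) * M)" if "\<alpha> \<in> exps (Suc n) M" for \<alpha>
    proof -
      obtain t \<beta> where \<alpha>: "\<alpha> = t # \<beta>" "t \<le> M" "\<beta> \<in> exps n M"
        using \<open>\<alpha> \<in> exps (Suc n) M\<close> by (auto simp: exps_def length_Suc_conv)
      have "deg_le (f ^ t * g \<beta>) (t * E + D * M)"
        using E g \<alpha> by (intro deg_le_mult deg_le_power)
      moreover have "t * E + D * M \<le> (E + D) * M"
        using mult_right_mono[OF \<alpha>(2), of E] by (simp add: algebra_simps)
      ultimately show ?thesis using \<alpha> g f(1)
        by (auto simp: h_def intro: deg_le_mono polys_mult polys_power)
    qed
    have "\<forall>\<alpha>\<in>exps (Suc n) M. u \<alpha> = 0"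
      if zero: "\<forall>p\<in>Z (Suc n). (\<Sum>\<alpha>\<in>exps (Suc n) M. u \<alpha> * cpoly_eval p (h \<alpha>)) = 0" for u
    proof -
      have "t \<le> M \<Longrightarrow> \<forall>\<alpha>\<in>exps n M. u (t # \<alpha>) = 0" for t
      proof (induction t rule: less_induct)
        case (less t)
        define r where "r = (\<Sum>s\<in>{t..M}. \<Sum>\<alpha>\<in>exps n M. cscale (u (s # \<alpha>)) (f ^ (s - t) * g \<alpha>))"
        have r_polys: "r \<in> polys X"
          unfolding r_def cscale_eq_mult using f(1) g(1)
          by (intro sum_in_polys polys_mult polys_power polys_const)
        have eval_r: "cpoly_eval p r =
            (\<Sum>s\<in>{t..M}. \<Sum>\<alpha>\<in>exps n M. u (s # \<alpha>) * (cpoly_eval p f ^ (s - t) * cpoly_eval p (g \<alpha>)))" for p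
          by (simp add: r_def)
        have prod: "cpoly_eval p (f ^ t) * cpoly_eval p r = 0" if "p \<in> Z (Suc n)" for p
        proof -
          have "0 = (\<Sum>s\<le>M. \<Sum>\<alpha>\<in>exps n M. u (s # \<alpha>) * (cpoly_eval p f ^ s * cpoly_eval p (g \<alpha>)))"
            using zero that by (simp add: sum_exps_Suc h_def)
          also have "\<dots> = (\<Sum>s\<in>{t..M}. \<Sum>\<alpha>\<in>exps n M. u (s # \<alpha>) * (cpoly_eval p f ^ s * cpoly_eval p (g \<alpha>)))"
            using less by (intro sum.mono_neutral_right) auto
          also have "\<dots> = (\<Sum>s\<in>{t..M}. \<Sum>\<alpha>\<in>exps n M.
              cpoly_eval p f ^ t * (u (s # \<alpha>) * (cpoly_eval p f ^ (s - t) * cpoly_eval p (g \<alpha>))))"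
          proof (intro sum.cong refl)
            fix s \<alpha> assume "s \<in> {t..M}"
            then have "cpoly_eval p f ^ s = cpoly_eval p f ^ t * cpoly_eval p f ^ (s - t)"
              by (simp flip: power_add)
            then show "u (s # \<alpha>) * (cpoly_eval p f ^ s * cpoly_eval p (g \<alpha>)) =
                cpoly_eval p f ^ t * (u (s # \<alpha>) * (cpoly_eval p f ^ (s - t) * cpoly_eval p (g \<alpha>)))"
              by simp
          qed
          also have "\<dots> = cpoly_eval p (f ^ t) * cpoly_eval p r"
            by (simp add: eval_r sum_distrib_left)
          finally show ?thesis by simp
        qed
        have "cpoly_eval p r = 0" if "p \<in> Z n" for p
          by (rule zariski_irreducible_zero_product[OF irr polys_power[OF f(1), of t] r_polys prod f(3)])
            (use f(4) that sub in auto)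
        moreover have "cpoly_eval p r = (\<Sum>\<alpha>\<in>exps n M. u (t # \<alpha>) * cpoly_eval p (g \<alpha>))" if "p \<in> Z n" for p
        proof -
          have "cpoly_eval p r = (\<Sum>s\<in>{t}. \<Sum>\<alpha>\<in>exps n M. u (s # \<alpha>) * (cpoly_eval p f ^ (s - t) * cpoly_eval p (g \<alpha>)))"
            unfolding eval_r using f(2)[OF that] less.prems
            by (intro sum.mono_neutral_right) (auto intro!: sum.neutral)
          then show ?thesis by simp
        qed
        ultimately show ?case by (intro g(3)) auto
      qed
      then show ?thesis by (auto simp: exps_def length_Suc_conv)
    qed
    with h show "\<exists>g. (\<forall>\<alpha>\<in>exps (Suc n) M. g \<alpha> \<in> polys X \<and> deg_le (g \<alpha>) ((E + D) * M)) \<and>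
      (\<forall>u. (\<forall>p\<in>Z (Suc n). (\<Sum>\<alpha>\<in>exps (Suc n) M. u \<alpha> * cpoly_eval p (g \<alpha>)) = 0) \<longrightarrow>
        (\<forall>\<alpha>\<in>exps (Suc n) M. u \<alpha> = 0))" by blast
  qed
qed

text \<open>
  Exponent vectors over \<open>J\<close> of total degree at most \<open>m\<close> that are reduced: the exponents
  outside of \<open>T\<close> are less than \<open>e\<close>.
\<close>

definition red_exps :: "'j set \<Rightarrow> 'j set \<Rightarrow> nat \<Rightarrow> nat \<Rightarrow> ('j \<Rightarrow> nat) set" where
  "red_exps J T e m = {\<beta> \<in> PiE J (\<lambda>j. if j \<in> T then {..m} else {..<e}). sum \<beta> J \<le> m}"

lemma finite_red_exps: "finite J \<Longrightarrow> finite (red_exps J T e m)"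
  unfolding red_exps_def by (rule finite_subset[OF _ finite_PiE[of J "\<lambda>j. if j \<in> T then {..m} else {..<e}"]]) auto

lemma card_red_exps:
  assumes "finite J" "T \<subseteq> J"
  shows "card (red_exps J T e m) \<le> (m + 1) ^ card T * e ^ card (J - T)"
proof -
  let ?P = "PiE J (\<lambda>j. if j \<in> T then {..m} else {..<e})"
  have "card (red_exps J T e m) \<le> card ?P"
    using assms by (intro card_mono finite_PiE) (auto simp: red_exps_def)
  also have "\<dots> = (\<Prod>j\<in>J. if j \<in> T then m + 1 else e)"
    using assms(1) by (simp add: card_PiE if_distrib cong: if_cong)
  also have "\<dots> = (m + 1) ^ card T * e ^ card (J - T)"
  proof -
    have "J \<inter> {x. x \<in> T} = T" "J \<inter> - {x. x \<in> T} = J - T" using assms(2) by auto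
    then show ?thesis using assms(1) by (simp add: prod.If_cases)
  qed
  finally show ?thesis .
qed

text \<open>
  The function \<open>q\<close> agrees on \<open>A\<close> with a linear combination of reduced monomials of degree at
  most \<open>m\<close> in the functions \<open>l\<^sub>j\<close>.
\<close>

definition red_span ::
    "('j \<Rightarrow> 'p \<Rightarrow> complex) \<Rightarrow> 'j set \<Rightarrow> 'j set \<Rightarrow> nat \<Rightarrow> 'p set \<Rightarrow> nat \<Rightarrow> ('p \<Rightarrow> complex) \<Rightarrow> bool" where
  "red_span l J T e A m q \<longleftrightarrow>
    (\<exists>u. \<forall>p\<in>A. q p = (\<Sum>\<beta>\<in>red_exps J T e m. u \<beta> * (\<Prod>j\<in>J. l j p ^ \<beta> j)))"

lemma red_span_cong: "(\<And>p. p \<in> A \<Longrightarrow> q p = q' p) \<Longrightarrow> red_span l J T e A m q = red_span l J T e A m q'"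
  by (auto simp: red_span_def)

lemma red_span_add:
  assumes "red_span l J T e A m q" "red_span l J T e A m q'"
  shows "red_span l J T e A m (\<lambda>p. q p + q' p)"
proof -
  obtain u u' where "\<forall>p\<in>A. q p = (\<Sum>\<beta>\<in>red_exps J T e m. u \<beta> * (\<Prod>j\<in>J. l j p ^ \<beta> j))"
    "\<forall>p\<in>A. q' p = (\<Sum>\<beta>\<in>red_exps J T e m. u' \<beta> * (\<Prod>j\<in>J. l j p ^ \<beta> j))"
    using assms by (auto simp: red_span_def)
  then show ?thesis unfolding red_span_def
    by (intro exI[of _ "\<lambda>\<beta>. u \<beta> + u' \<beta>"]) (simp add: distrib_right sum.distrib)
qed

lemma red_span_scale:
  assumes "red_span l J T e A m q"
  shows "red_span l J T e A m (\<lambda>p. c * q p)"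
proof -
  obtain u where "\<forall>p\<in>A. q p = (\<Sum>\<beta>\<in>red_exps J T e m. u \<beta> * (\<Prod>j\<in>J. l j p ^ \<beta> j))"
    using assms by (auto simp: red_span_def)
  then show ?thesis unfolding red_span_def
    by (intro exI[of _ "\<lambda>\<beta>. c * u \<beta>"]) (simp add: sum_distrib_left mult.assoc)
qed

lemma red_span_sum:
  assumes "\<And>i. i \<in> I \<Longrightarrow> red_span l J T e A m (q i)"
  shows "red_span l J T e A m (\<lambda>p. \<Sum>i\<in>I. q i p)"
proof -
  have 0: "red_span l J T e A m (\<lambda>p. 0)"
    unfolding red_span_def by (intro exI[of _ "\<lambda>_. 0"]) auto
  show ?thesis using assms
    by (induction I rule: infinite_finite_induct) (auto simp: 0 red_span_add)
qed

lemma red_span_monomial: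
  assumes "finite J" "\<beta> \<in> red_exps J T e m"
  shows "red_span l J T e A m (\<lambda>p. \<Prod>j\<in>J. l j p ^ \<beta> j)"
proof -
  have "(\<Sum>\<gamma>\<in>red_exps J T e m. (if \<gamma> = \<beta> then 1 else 0) * (\<Prod>j\<in>J. l j p ^ \<gamma> j)) =
      (\<Sum>\<gamma>\<in>red_exps J T e m. if \<gamma> = \<beta> then \<Prod>j\<in>J. l j p ^ \<gamma> j else 0)" for p
    by (intro sum.cong) auto
  then show ?thesis
    unfolding red_span_def using assms finite_red_exps[OF assms(1)]
    by (intro exI[of _ "\<lambda>\<gamma>. if \<gamma> = \<beta> then 1 else 0"]) simp
qed

lemma red_span_mono:
  assumes "finite J" "red_span l J T e A m q" "m \<le> n"
  shows "red_span l J T e A n q"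
proof -
  obtain u where "\<forall>p\<in>A. q p = (\<Sum>\<beta>\<in>red_exps J T e m. u \<beta> * (\<Prod>j\<in>J. l j p ^ \<beta> j))"
    using assms by (auto simp: red_span_def)
  moreover have "red_exps J T e m \<subseteq> red_exps J T e n"
    using assms(3) by (fastforce simp: red_exps_def PiE_iff split: if_splits)
  then have "red_span l J T e A n (\<lambda>p. \<Sum>\<beta>\<in>red_exps J T e m. u \<beta> * (\<Prod>j\<in>J. l j p ^ \<beta> j))"
    by (intro red_span_sum red_span_scale red_span_monomial[OF assms(1)]) auto
  ultimately show ?thesis by (subst red_span_cong) auto
qed

text \<open>
  If multiplication by \<open>l\<^sub>j\<close> makes an exponent reach \<open>e\<close>, then \<open>l\<^sub>j\<^sup>e\<close> is replaced by a combination
  of the \<open>l\<^sub>t\<^sup>e\<close> with \<open>t \<in> T\<close>, which preserves the total degree.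
\<close>

lemma red_span_times:
  assumes J: "finite J" "T \<subseteq> J" and j: "j \<in> J" and "e > 0"
    and rel: "\<And>j. j \<in> J - T \<Longrightarrow> \<exists>c. \<forall>p\<in>A. l j p ^ e = (\<Sum>t\<in>T. c t * l t p ^ e)"
    and q: "red_span l J T e A m q"
  shows "red_span l J T e A (Suc m) (\<lambda>p. l j p * q p)"
proof -
  obtain u where u: "\<forall>p\<in>A. q p = (\<Sum>\<beta>\<in>red_exps J T e m. u \<beta> * (\<Prod>j\<in>J. l j p ^ \<beta> j))"
    using q by (auto simp: red_span_def)
  have sum_upd: "sum (\<beta>(i := x)) J + \<beta> i = sum \<beta> J + x" if "i \<in> J" for \<beta> :: "'a \<Rightarrow> nat" and i x
  proof -
    have "(\<Sum>j\<in>J - {i}. (\<beta>(i := x)) j) = (\<Sum>j\<in>J - {i}. \<beta> j)" by (intro sum.cong) auto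
    then show ?thesis using J(1) that by (simp add: sum.remove[of J i])
  qed
  have prod_upd: "l i p ^ x * (\<Prod>j\<in>J. l j p ^ \<beta> j) = (\<Prod>j\<in>J. l j p ^ (\<beta>(i := \<beta> i + x)) j)"
    if "i \<in> J" for \<beta> :: "'a \<Rightarrow> nat" and i x p
  proof -
    have "(\<Prod>j\<in>J - {i}. l j p ^ (\<beta>(i := \<beta> i + x)) j) = (\<Prod>j\<in>J - {i}. l j p ^ \<beta> j)"
      by (intro prod.cong) auto
    then show ?thesis using J(1) that by (simp add: prod.remove[of J i] power_add mult_ac)
  qed
  have mon: "red_span l J T e A (Suc m) (\<lambda>p. l j p * (\<Prod>j\<in>J. l j p ^ \<beta> j))"
    if \<beta>: "\<beta> \<in> red_exps J T e m" for \<beta>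
  proof (cases "j \<in> T \<or> \<beta> j + 1 < e")
    case True
    have "\<beta>(j := \<beta> j + 1) \<in> red_exps J T e (Suc m)"
      using True \<beta> j sum_upd[OF j, of \<beta> "\<beta> j + 1"]
      by (fastforce simp: red_exps_def PiE_iff extensional_def split: if_splits)
    from red_span_monomial[OF J(1) this, of l A] show ?thesis
      using prod_upd[OF j, of _ 1 \<beta>] by simp
  next
    case False
    moreover have "\<beta> j < e" using \<beta> j False by (auto simp: red_exps_def PiE_iff split: if_splits)
    ultimately have e: "e = \<beta> j + 1" and jT: "j \<in> J - T" using j by auto
    obtain c where c: "\<forall>p\<in>A. l j p ^ e = (\<Sum>t\<in>T. c t * l t p ^ e)" using rel[OF jT] by blast
    define \<gamma> where "\<gamma> t = (\<beta>(j := 0))(t := \<beta> t + e)" for t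
    have \<gamma>: "\<gamma> t \<in> red_exps J T e (Suc m)" if t: "t \<in> T" for t
    proof -
      have "t \<in> J" "t \<noteq> j" using t J jT by auto
      then have "sum (\<gamma> t) J \<le> Suc m"
        using sum_upd[OF \<open>t \<in> J\<close>, of "\<beta>(j := 0)" "\<beta> t + e"] sum_upd[OF j, of \<beta> 0] e \<beta>
        by (simp add: \<gamma>_def red_exps_def)
      moreover have "\<gamma> t t \<le> sum (\<gamma> t) J"
        using J(1) \<open>t \<in> J\<close> by (intro member_le_sum) auto
      ultimately show ?thesis using \<beta> t \<open>t \<in> J\<close> \<open>t \<noteq> j\<close> j jT \<open>e > 0\<close>
        by (fastforce simp: red_exps_def PiE_iff extensional_def \<gamma>_def split: if_splits)
    qed
    have "l j p * (\<Prod>j\<in>J. l j p ^ \<beta> j) = (\<Sum>t\<in>T. c t * (\<Prod>j\<in>J. l j p ^ \<gamma> t j))" if p: "p \<in> A" for p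
    proof -
      have "l j p * (\<Prod>j\<in>J. l j p ^ \<beta> j) = l j p ^ e * (\<Prod>i\<in>J. l i p ^ (\<beta>(j := 0)) i)"
        using prod_upd[OF j, of p 1 \<beta>] prod_upd[OF j, of p e "\<beta>(j := 0)"] e by simp
      also have "\<dots> = (\<Sum>t\<in>T. c t * (l t p ^ e * (\<Prod>i\<in>J. l i p ^ (\<beta>(j := 0)) i)))"
        using c p by (simp add: sum_distrib_right mult.assoc)
      also have "\<dots> = (\<Sum>t\<in>T. c t * (\<Prod>j\<in>J. l j p ^ \<gamma> t j))"
      proof (intro sum.cong refl)
        fix t assume "t \<in> T"
        then have "t \<in> J" "t \<noteq> j" using J jT by auto
        then show "c t * (l t p ^ e * (\<Prod>i\<in>J. l i p ^ (\<beta>(j := 0)) i)) = c t * (\<Prod>j\<in>J. l j p ^ \<gamma> t j)"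
          using prod_upd[of t p e "\<beta>(j := 0)"] by (simp add: \<gamma>_def)
      qed
      finally show ?thesis .
    qed
    moreover have "red_span l J T e A (Suc m) (\<lambda>p. \<Sum>t\<in>T. c t * (\<Prod>j\<in>J. l j p ^ \<gamma> t j))"
      using \<gamma> by (intro red_span_sum red_span_scale red_span_monomial J) auto
    ultimately show ?thesis by (subst red_span_cong) auto
  qed
  have "red_span l J T e A (Suc m)
      (\<lambda>p. \<Sum>\<beta>\<in>red_exps J T e m. u \<beta> * (l j p * (\<Prod>j\<in>J. l j p ^ \<beta> j)))"
    by (intro red_span_sum red_span_scale mon)
  then show ?thesis
    by (subst red_span_cong) (auto simp: u sum_distrib_left mult_ac)
qed

lemma red_span_eval:
  assumes J: "finite J" "T \<subseteq> J" and "e > 0"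
    and rel: "\<And>j. j \<in> J - T \<Longrightarrow> \<exists>c. \<forall>p\<in>A. l j p ^ e = (\<Sum>t\<in>T. c t * l t p ^ e)"
    and coord: "\<And>v. v \<in> X \<Longrightarrow> \<exists>b. \<forall>p\<in>A. p v = (\<Sum>j\<in>J. b j * l j p)"
    and f: "f \<in> polys X" "deg_le f m"
  shows "red_span l J T e A m (\<lambda>p. cpoly_eval p f)"
proof -
  have coord_times: "red_span l J T e A (Suc m) (\<lambda>p. p v * q p)"
    if "v \<in> X" "red_span l J T e A m q" for v m q
  proof -
    obtain b where b: "\<forall>p\<in>A. p v = (\<Sum>j\<in>J. b j * l j p)" using coord \<open>v \<in> X\<close> by blast
    have "red_span l J T e A (Suc m) (\<lambda>p. \<Sum>j\<in>J. b j * (l j p * q p))"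
      using that J rel \<open>e > 0\<close> by (intro red_span_sum red_span_scale red_span_times) auto
    then show ?thesis by (subst red_span_cong) (auto simp: b sum_distrib_right mult.assoc)
  qed
  have mon: "keys k \<subseteq> X \<Longrightarrow> mdegree k = n \<Longrightarrow> red_span l J T e A n (\<lambda>p. mon_eval p k)" for k n
  proof (induction n arbitrary: k)
    case 0
    have "(\<lambda>j\<in>J. 0) \<in> red_exps J T e 0" using \<open>e > 0\<close> by (auto simp: red_exps_def)
    from red_span_monomial[OF J(1) this, of l A] 0 show ?case
      by (simp add: mon_eval_def)
  next
    case (Suc n)
    then have "k \<noteq> 0" by auto
    then obtain v where v: "v \<in> keys k" by (metis keys_eq_empty ex_in_conv)
    define k' where "k' = k - single v 1"
    have k: "k = single v 1 + k'"
      using v by (intro poly_mapping_eqI)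
        (auto simp: k'_def lookup_add lookup_minus lookup_single when_def in_keys_iff)
    have "mdegree k' = n" using Suc.prems(2) by (simp add: k mdegree_add)
    moreover have "keys k' \<subseteq> X" using Suc.prems(1) by (simp add: k keys_add_nat)
    ultimately have "red_span l J T e A (Suc n) (\<lambda>p. p v * mon_eval p k')"
      using v Suc by (intro coord_times) auto
    moreover have "mon_eval p k = p v * mon_eval p k'" for p
      by (simp add: k mon_eval_add) (simp add: mon_eval_def)
    ultimately show ?case by simp
  qed
  have "red_span l J T e A m (\<lambda>p. mon_eval p k)" if "k \<in> keys f" for k
    by (rule red_span_mono[OF J(1) mon[OF _ refl]]) (use that f in \<open>auto simp: polys_def deg_le_def\<close>)
  then show ?thesis unfolding cpoly_eval_alt by (intro red_span_sum red_span_scale)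
qed

text \<open>
  A set on which the coordinates are linear combinations of functions \<open>l\<^sub>j\<close>, with \<open>l\<^sub>j\<^sup>e\<close> for
  \<open>j \<notin> T\<close> a linear combination of the \<open>l\<^sub>t\<^sup>e\<close> with \<open>t \<in> T\<close>, has dimension at most \<open>|T|\<close>.
\<close>

lemma alg_dim_le_card:
  assumes J: "finite J" "T \<subseteq> J" and "e > 0"
    and rel: "\<And>j. j \<in> J - T \<Longrightarrow> \<exists>c. \<forall>p\<in>A. l j p ^ e = (\<Sum>t\<in>T. c t * l t p ^ e)"
    and coord: "\<And>v. v \<in> X \<Longrightarrow> \<exists>b. \<forall>p\<in>A. p v = (\<Sum>j\<in>J. b j * l j p)"
  shows "alg_dim X A \<le> enat (card T)"
proof (rule alg_dim_leI)
  fix Z n assume chain: "irr_chain X Z n" and ZA: "Z n \<subseteq> A"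
  obtain D where D: "\<And>M. \<exists>g. (\<forall>\<alpha>\<in>exps n M. g \<alpha> \<in> polys X \<and> deg_le (g \<alpha>) (D * M)) \<and>
    (\<forall>u. (\<forall>p\<in>Z n. (\<Sum>\<alpha>\<in>exps n M. u \<alpha> * cpoly_eval p (g \<alpha>)) = 0) \<longrightarrow> (\<forall>\<alpha>\<in>exps n M. u \<alpha> = 0))"
    using irr_chain_independent_family[OF chain] by blast
  define C where "C = e ^ card (J - T)"
  have bound: "(M + 1) ^ n \<le> (D * M + 1) ^ card T * C" for M
  proof (rule ccontr)
    assume *: "\<not> ?thesis"
    let ?K = "red_exps J T e (D * M)"
    obtain g where g: "\<And>\<alpha>. \<alpha> \<in> exps n M \<Longrightarrow> g \<alpha> \<in> polys X" "\<And>\<alpha>. \<alpha> \<in> exps n M \<Longrightarrow> deg_le (g \<alpha>) (D * M)"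
      "\<And>u. (\<forall>p\<in>Z n. (\<Sum>\<alpha>\<in>exps n M. u \<alpha> * cpoly_eval p (g \<alpha>)) = 0) \<Longrightarrow> (\<forall>\<alpha>\<in>exps n M. u \<alpha> = 0)"
      using D[of M] by blast
    have "red_span l J T e A (D * M) (\<lambda>p. cpoly_eval p (g \<alpha>))" if "\<alpha> \<in> exps n M" for \<alpha>
      using that by (intro red_span_eval[where X = X] assms g)
    then have "\<forall>\<alpha>\<in>exps n M. \<exists>a. \<forall>p\<in>A. cpoly_eval p (g \<alpha>) = (\<Sum>\<beta>\<in>?K. a \<beta> * (\<Prod>j\<in>J. l j p ^ \<beta> j))"
      unfolding red_span_def by blast
    then obtain a where a: "\<And>\<alpha> p. \<alpha> \<in> exps n M \<Longrightarrow> p \<in> A \<Longrightarrow>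
        cpoly_eval p (g \<alpha>) = (\<Sum>\<beta>\<in>?K. a \<alpha> \<beta> * (\<Prod>j\<in>J. l j p ^ \<beta> j))"
      using bchoice[of "exps n M" "\<lambda>\<alpha> a. \<forall>p\<in>A. cpoly_eval p (g \<alpha>) = (\<Sum>\<beta>\<in>?K. a \<beta> * (\<Prod>j\<in>J. l j p ^ \<beta> j))"]
      by blast
    have "card ?K < card (exps n M)"
      using * card_red_exps[OF J, of e "D * M"] by (simp add: card_exps C_def)
    from nontrivial_relation[OF finite_red_exps[OF J(1)] finite_exps this, of a]
    obtain u where u: "\<exists>\<alpha>\<in>exps n M. u \<alpha> \<noteq> 0" "\<And>\<beta>. \<beta> \<in> ?K \<Longrightarrow> (\<Sum>\<alpha>\<in>exps n M. u \<alpha> * a \<alpha> \<beta>) = 0"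
      by blast
    have "(\<Sum>\<alpha>\<in>exps n M. u \<alpha> * cpoly_eval p (g \<alpha>)) = 0" if "p \<in> Z n" for p
    proof -
      have "p \<in> A" using that ZA by auto
      then have "(\<Sum>\<alpha>\<in>exps n M. u \<alpha> * cpoly_eval p (g \<alpha>)) =
          (\<Sum>\<alpha>\<in>exps n M. \<Sum>\<beta>\<in>?K. u \<alpha> * a \<alpha> \<beta> * (\<Prod>j\<in>J. l j p ^ \<beta> j))"
        by (simp add: a sum_distrib_left mult.assoc)
      also have "\<dots> = (\<Sum>\<beta>\<in>?K. (\<Sum>\<alpha>\<in>exps n M. u \<alpha> * a \<alpha> \<beta>) * (\<Prod>j\<in>J. l j p ^ \<beta> j))"
        by (subst sum.swap) (simp add: sum_distrib_right)
      also have "\<dots> = 0" using u(2) by simp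
      finally show ?thesis .
    qed
    then show False using g(3)[of u] u(1) by blast
  qed
  have "n \<le> card T"
  proof (rule ccontr)
    assume "\<not> n \<le> card T"
    define s where "s = card T"
    \<comment> \<open>If \<open>n > s\<close>, the bound implies \<open>M + 1 \<le> (D + 1)\<^sup>s * C\<close> for all \<open>M\<close>.\<close>
    define M where "M = (D + 1) ^ s * C"
    have "(M + 1) ^ s * (M + 1) \<le> (M + 1) ^ n"
      using \<open>\<not> n \<le> card T\<close> power_increasing[of "Suc s" n "M + 1"] by (simp add: s_def mult.commute)
    also have "\<dots> \<le> (D * M + 1) ^ s * C" using bound[of M] by (simp add: s_def)
    also have "\<dots> \<le> ((D + 1) * (M + 1)) ^ s * C"
      by (intro mult_right_mono power_mono) (auto simp: algebra_simps)
    also have "\<dots> = (M + 1) ^ s * M" by (simp only: M_def power_mult_distrib mult_ac)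
    finally show False by simp
  qed
  then show "enat n \<le> enat (card T)" by simp
qed

corollary alg_dim_le_card_vars:
  assumes "finite X"
  shows "alg_dim X A \<le> enat (card X)"
proof (rule alg_dim_le_card[of X X 1 A "\<lambda>v p. p v"])
  fix v assume "v \<in> X"
  have "(\<Sum>j\<in>X. (if j = v then 1 else 0) * p j) = (\<Sum>j\<in>X. if j = v then p j else 0)" for p :: "'a \<Rightarrow> complex"
    by (intro sum.cong) auto
  then show "\<exists>b. \<forall>p\<in>A. p v = (\<Sum>j\<in>X. b j * p j)"
    using assms \<open>v \<in> X\<close> by (intro exI[of _ "\<lambda>j. if j = v then 1 else 0"]) simp
qed (use assms in auto)

section \<open>Waring decompositions\<close>

text \<open>The ring homomorphism that sets all variables outside of \<open>X\<close> to zero.\<close>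

definition kill :: "'v set \<Rightarrow> 'v cpoly \<Rightarrow> 'v cpoly" where
  "kill X p = (\<Sum>m\<in>keys p. if keys m \<subseteq> X then single m (lookup p m) else 0)"

lemma kill_add: "kill X (p + q) = kill X p + kill X q"
  unfolding kill_def
  by (rule setsum_keys_plus_distrib[where f = "\<lambda>m c. if keys m \<subseteq> X then single m c else 0"])
    (auto simp: single_add)

lemma kill_single: "kill X (single m c) = (if keys m \<subseteq> X then single m c else 0)"
  by (simp add: kill_def)

lemma kill_mult: "kill X (p * q) = kill X p * kill X q"
proof -
  have 1: "kill X (single m c * q) = kill X (single m c) * kill X q" for m c
    using polys_UNIV[of q]
    by (induction q rule: polys_monomial_induct)
      (auto simp: mult_single kill_single keys_add_nat kill_add distrib_left)
  show ?thesis using polys_UNIV[of p]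
    by (induction p rule: polys_monomial_induct) (simp_all add: 1 kill_add distrib_right)
qed

lemma kill_one: "kill X 1 = 1"
  using kill_single[of X 0 1] by simp

lemma kill_power: "kill X (p ^ n) = kill X p ^ n"
  by (induction n) (simp_all add: kill_one kill_mult)

lemma kill_sum: "kill X (\<Sum>i\<in>I. f i) = (\<Sum>i\<in>I. kill X (f i))"
proof -
  have "kill X 0 = 0" by (simp add: kill_def)
  then show ?thesis by (induction I rule: infinite_finite_induct) (simp_all add: kill_add)
qed

lemma kill_id: "p \<in> polys X \<Longrightarrow> kill X p = p"
  by (induction p rule: polys_monomial_induct) (simp_all add: kill_single kill_add)

lemma kill_forms: "p \<in> forms Y d \<Longrightarrow> kill X p \<in> forms X d"
  unfolding kill_def
  by (intro cpoly.subspace_sum[OF subspace_forms])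
    (auto simp: forms_def intro: polys_single)

lemma waring_rank_le:
  assumes "\<And>i. i < r \<Longrightarrow> l i \<in> forms UNIV 1" "F = (\<Sum>i<r. l i ^ d)"
  shows "waring_rank d F \<le> enat r"
  unfolding waring_rank_def by (rule Inf_lower) (use assms in auto)

text \<open>
  The definition of the rank admits linear forms in arbitrary variables; setting the variables
  that do not occur in \<open>F\<close> to zero yields linear forms in those of \<open>F\<close>.
\<close>

lemma waring_rank_decomposition:
  assumes "waring_rank d F = enat r" "F \<in> polys X"
  obtains l where "\<And>i. i < r \<Longrightarrow> l i \<in> forms X 1" "F = (\<Sum>i<r. l i ^ d)"
proof -
  let ?S = "{enat r | r. \<exists>l. (\<forall>i<r. l i \<in> forms UNIV 1) \<and> F = (\<Sum>i<r. l i ^ d)}"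
  have eq: "Inf ?S = enat r" using assms(1) by (simp add: waring_rank_def)
  then have ne: "?S \<noteq> {}" by (metis Inf_empty enat.distinct(1) top_enat_def)
  then have "Inf ?S \<in> ?S" unfolding Inf_enat_def using LeastI[of "\<lambda>x. x \<in> ?S"] by auto
  then obtain l where l: "\<forall>i<r. l i \<in> forms UNIV 1" "F = (\<Sum>i<r. l i ^ d)"
    unfolding eq by auto
  have "F = kill X (\<Sum>i<r. l i ^ d)" using kill_id[OF assms(2)] l by simp
  then have "F = (\<Sum>i<r. kill X (l i) ^ d)" by (simp add: kill_sum kill_power)
  then show thesis using l by (intro that[of "\<lambda>i. kill X (l i)"] kill_forms) auto
qed

lemma power_in_sym_power: "w \<in> W \<Longrightarrow> w ^ d \<in> sym_power d W"
  unfolding sym_power_def by (rule cpoly.span_base) (auto intro!: exI[of _ "\<lambda>_. w"])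

lemma sum_powers_in_sym_power: "(\<And>i. i \<in> I \<Longrightarrow> w i \<in> W) \<Longrightarrow> (\<Sum>i\<in>I. w i ^ d) \<in> sym_power d W"
  unfolding sym_power_def
  by (intro cpoly.span_sum) (use power_in_sym_power[unfolded sym_power_def] in blast)

lemma sum_lessThan_add: "(\<Sum>i<r + s. f i) = (\<Sum>i<r. f i) + (\<Sum>i<s. f (r + i))"
  for f :: "nat \<Rightarrow> 'a::comm_monoid_add"
  by (induction s) (simp_all add: add.assoc)

lemma waring_rank_zero: "waring_rank d 0 = 0"
  using waring_rank_le[of 0 "\<lambda>_. 0" 0 d] by (simp flip: zero_enat_def)

lemma waring_rank_add_le: "waring_rank d (F + G) \<le> waring_rank d F + waring_rank d G"
proof (cases "waring_rank d F = \<infinity> \<or> waring_rank d G = \<infinity>")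
  case False
  then obtain r s where rs: "waring_rank d F = enat r" "waring_rank d G = enat s" by auto
  obtain l where l: "\<And>i. i < r \<Longrightarrow> l i \<in> forms UNIV 1" "F = (\<Sum>i<r. l i ^ d)"
    by (rule waring_rank_decomposition[OF rs(1), of UNIV]) auto
  obtain m where m: "\<And>i. i < s \<Longrightarrow> m i \<in> forms UNIV 1" "G = (\<Sum>i<s. m i ^ d)"
    by (rule waring_rank_decomposition[OF rs(2), of UNIV]) auto
  have "waring_rank d (F + G) \<le> enat (r + s)"
    by (rule waring_rank_le[of _ "\<lambda>i. if i < r then l i else m (i - r)"])
      (use l m in \<open>auto simp: sum_lessThan_add\<close>)
  then show ?thesis by (simp add: rs)
qed auto

lemma waring_rank_sum_le: "waring_rank d (\<Sum>i\<in>I. F i) \<le> (\<Sum>i\<in>I. waring_rank d (F i))"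
proof (induction I rule: infinite_finite_induct)
  case (insert i I)
  then show ?case
    using waring_rank_add_le[of d "F i" "\<Sum>i\<in>I. F i"] by (auto intro: order_trans add_left_mono)
qed (simp_all add: waring_rank_zero)

lemma eval_in_span:
  assumes "x \<in> cpoly.span (l ` J)" "finite J"
  shows "\<exists>b. \<forall>p. cpoly_eval p x = (\<Sum>j\<in>J. b j * cpoly_eval p (l j))"
  using assms(1)
proof (induction rule: cpoly.span_induct_alt)
  case base
  show ?case by (intro exI[of _ "\<lambda>_. 0"]) simp
next
  case (step c x y)
  then obtain b i where b: "\<And>p. cpoly_eval p y = (\<Sum>j\<in>J. b j * cpoly_eval p (l j))"
    and i: "i \<in> J" "x = l i" by blast
  have "(\<Sum>j\<in>J. (b j + (if j = i then c else 0)) * cpoly_eval p (l j)) =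
      (\<Sum>j\<in>J. b j * cpoly_eval p (l j) + (if j = i then c * cpoly_eval p (l j) else 0))" for p
    by (intro sum.cong) (auto simp: distrib_right)
  then show ?case using i assms(2)
    by (intro exI[of _ "\<lambda>j. b j + (if j = i then c else 0)"]) (simp add: b sum.distrib)
qed

section \<open>The lower bound of Landsberg and Teitler\<close>

lemma landsberg_teitler_bound:
  fixes l :: "nat \<Rightarrow> 'v cpoly"
  assumes X: "finite X" and conc: "concise X d F" and a: "1 \<le> a" "a \<le> d - 1"
    and l: "\<And>j. j < r \<Longrightarrow> l j \<in> forms X 1" and F: "F = (\<Sum>j<r. l j ^ d)"
  shows "enat (cpoly.dim (derivs_space X d F (d - a))) + alg_dim X (Sigma_locus X a F) \<le> enat r"
proof -
  define J where "J = {..<r}"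
  have J: "finite J" and lJ: "\<And>j. j \<in> J \<Longrightarrow> l j \<in> forms X 1" and FJ: "F = (\<Sum>j\<in>J. l j ^ d)"
    using l F by (auto simp: J_def)
  define e where "e = d - a"
  have e: "e > 0" "d - e = a" using a by (auto simp: e_def)
  \<comment> \<open>The vector \<open>c\<^sub>j\<close> of products of \<open>a\<close> coefficients of \<open>l\<^sub>j\<close>, indexed by lists of \<open>a\<close> variables\<close>
  \<comment> \<open>and extended by 0 to all lists.\<close>
  define c where "c j vs = (if set vs \<subseteq> X \<and> length vs = a then prod_list (map (lcoeff (l j)) vs) else 0)" for j vs
  define \<kappa> where "\<kappa> = complex_of_nat (\<Prod>i<a. d - i)"
  have "\<kappa> \<noteq> 0" using a by (auto simp: \<kappa>_def)
  obtain B \<gamma> where B: "B \<subseteq> J"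
    and indep: "\<And>u. (\<And>vs. (\<Sum>b\<in>B. u b * c b vs) = 0) \<Longrightarrow> \<forall>b\<in>B. u b = 0"
    and \<gamma>: "\<And>j vs. j \<in> J \<Longrightarrow> c j vs = (\<Sum>b\<in>B. \<gamma> j b * c b vs)"
    using maximal_independent_subfamily[OF J, of c] by blast
  have finB: "finite B" using B J by (rule finite_subset)
  \<comment> \<open>All entries of the vector \<open>\<Sum>\<^sub>j c\<^sub>j l\<^sub>j\<^sup>e\<close> are derivatives of \<open>F\<close> divided by \<open>\<kappa>\<close>, or 0.\<close>
  have derivs: "partial_derivs vs F = (\<Sum>j\<in>J. cscale (\<kappa> * c j vs) (l j ^ e))"
    if "set vs \<subseteq> X" "length vs = a" for vs
    unfolding FJ partial_derivs_sum using that
    by (intro sum.cong refl, subst partial_derivs_power[OF lJ]) (simp_all add: c_def \<kappa>_def e_def)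
  have "cpoly.dim (derivs_space X d F e) \<le> card B"
  proof -
    define w where "w b = (\<Sum>j\<in>J. cscale (\<gamma> j b) (l j ^ e))" for b
    have "partial_derivs vs F \<in> cpoly.span (w ` B)" if "set vs \<subseteq> X" "length vs = a" for vs
    proof -
      have "partial_derivs vs F = (\<Sum>j\<in>J. \<Sum>b\<in>B. cscale (\<kappa> * c b vs) (cscale (\<gamma> j b) (l j ^ e)))"
        unfolding derivs[OF that]
      proof (intro sum.cong refl)
        fix j assume "j \<in> J"
        then show "cscale (\<kappa> * c j vs) (l j ^ e) =
            (\<Sum>b\<in>B. cscale (\<kappa> * c b vs) (cscale (\<gamma> j b) (l j ^ e)))"
          by (simp add: \<gamma> sum_distrib_left mult_ac flip: cpoly.scale_sum_left)
      qed
      also have "\<dots> = (\<Sum>b\<in>B. cscale (\<kappa> * c b vs) (w b))"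
        unfolding w_def cpoly.scale_sum_right by (rule sum.swap)
      also have "\<dots> \<in> cpoly.span (w ` B)"
        by (intro cpoly.span_sum cpoly.span_scale cpoly.span_base) auto
      finally show ?thesis .
    qed
    then have "derivs_space X d F e \<subseteq> cpoly.span (w ` B)"
      unfolding derivs_space_def e(2) by (intro cpoly.span_minimal) auto
    then have "cpoly.dim (derivs_space X d F e) \<le> card (w ` B)"
      using finB by (intro cpoly.dim_le_card) auto
    also have "\<dots> \<le> card B" using finB by (rule card_image_le)
    finally show ?thesis .
  qed
  moreover have "alg_dim X (Sigma_locus X a F) \<le> enat (card (J - B))"
  proof (rule alg_dim_le_card[OF J _ e(1), where l = "\<lambda>j p. cpoly_eval p (l j)"])
    fix j assume "j \<in> J - (J - B)"
    then have j: "j \<in> B" using B by auto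
    have "cpoly_eval p (l j) ^ e = (\<Sum>t\<in>J - B. - \<gamma> t j * cpoly_eval p (l t) ^ e)"
      if p: "p \<in> Sigma_locus X a F" for p
    proof -
      define y where "y j = cpoly_eval p (l j) ^ e" for j
      have rel: "(\<Sum>j\<in>J. y j * c j vs) = 0" for vs
      proof (cases "set vs \<subseteq> X \<and> length vs = a")
        case True
        then have "cpoly_eval p (partial_derivs vs F) = 0" using p by (auto simp: Sigma_locus_def)
        then have "\<kappa> * (\<Sum>j\<in>J. y j * c j vs) = 0"
          using derivs[of vs] True by (simp add: y_def sum_distrib_left mult_ac)
        then show ?thesis using \<open>\<kappa> \<noteq> 0\<close> by simp
      next
        case False
        then have "c j vs = 0" for j by (auto simp: c_def)
        then show ?thesis by simp
      qed
      have "(\<Sum>b\<in>B. (y b + (\<Sum>t\<in>J - B. \<gamma> t b * y t)) * c b vs) = 0" for vs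
      proof -
        have "(\<Sum>b\<in>B. \<Sum>t\<in>J - B. \<gamma> t b * y t * c b vs) = (\<Sum>t\<in>J - B. y t * c t vs)"
          by (subst sum.swap) (simp add: \<gamma> sum_distrib_left mult_ac)
        then have "(\<Sum>b\<in>B. (y b + (\<Sum>t\<in>J - B. \<gamma> t b * y t)) * c b vs) =
            (\<Sum>t\<in>J - B. y t * c t vs) + (\<Sum>b\<in>B. y b * c b vs)"
          by (simp add: distrib_right sum.distrib sum_distrib_right)
        also have "\<dots> = (\<Sum>j\<in>J. y j * c j vs)" by (rule sum.subset_diff[OF B J, symmetric])
        finally show ?thesis using rel by simp
      qed
      from indep[OF this] j have "y j + (\<Sum>t\<in>J - B. \<gamma> t j * y t) = 0" by blast
      then show ?thesis by (simp add: y_def sum_negf eq_neg_iff_add_eq_0)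
    qed
    then show "\<exists>c. \<forall>p\<in>Sigma_locus X a F. cpoly_eval p (l j) ^ e = (\<Sum>t\<in>J - B. c t * cpoly_eval p (l t) ^ e)"
      by (intro exI[of _ "\<lambda>t. - \<gamma> t j"]) blast
  next
    fix v assume v: "v \<in> X"
    \<comment> \<open>Conciseness of \<open>F\<close>, applied to the span of the \<open>l\<^sub>j\<close>.\<close>
    have "cpoly.span (l ` J) = forms X 1"
    proof -
      have "cpoly.subspace (cpoly.span (l ` J))" by simp
      moreover have "cpoly.span (l ` J) \<subseteq> forms X 1"
        using lJ by (intro cpoly.span_minimal subspace_forms) auto
      moreover have "F \<in> sym_power d (cpoly.span (l ` J))"
        unfolding FJ by (intro sum_powers_in_sym_power cpoly.span_base) auto
      ultimately show ?thesis using conc by (simp add: concise_def)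
    qed
    then have "var v \<in> cpoly.span (l ` J)" using forms_var[OF v] by simp
    from eval_in_span[OF this J]
    show "\<exists>b. \<forall>p\<in>Sigma_locus X a F. p v = (\<Sum>j\<in>J. b j * cpoly_eval p (l j))" by auto
  qed auto
  ultimately have "enat (cpoly.dim (derivs_space X d F e)) + alg_dim X (Sigma_locus X a F) \<le>
      enat (card B) + enat (card (J - B))"
    by (intro add_mono) auto
  also have "\<dots> = enat r"
    using B J card_mono[OF J B] by (simp add: card_Diff_subset finB J_def)
  finally show ?thesis by (simp add: e_def)
qed

section \<open>Conciseness of a sum\<close>

lemma eval_linear_form:
  assumes "finite X" "l \<in> forms X 1"
  shows "cpoly_eval p l = (\<Sum>v\<in>X. lcoeff l v * p v)"
  by (subst linear_form_eq_sum[OF assms]) simp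

text \<open>The derivative in the direction \<open>p\<close> with respect to the variables \<open>X\<close>.\<close>

definition dir_deriv :: "'v set \<Rightarrow> ('v \<Rightarrow> complex) \<Rightarrow> 'v cpoly \<Rightarrow> 'v cpoly" where
  "dir_deriv X p f = (\<Sum>v\<in>X. cscale (p v) (partial_deriv v f))"

lemma dir_deriv_add: "dir_deriv X p (f + g) = dir_deriv X p f + dir_deriv X p g"
  by (simp add: dir_deriv_def partial_deriv_add cpoly.scale_right_distrib sum.distrib)

lemma dir_deriv_zero [simp]: "dir_deriv X p 0 = 0"
  by (simp add: dir_deriv_def)

lemma dir_deriv_sum: "dir_deriv X p (\<Sum>i\<in>I. f i) = (\<Sum>i\<in>I. dir_deriv X p (f i))"
  by (induction I rule: infinite_finite_induct) (simp_all add: dir_deriv_add)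

lemma dir_deriv_cscale: "dir_deriv X p (cscale c f) = cscale c (dir_deriv X p f)"
  by (simp add: dir_deriv_def partial_deriv_cscale cpoly.scale_sum_right mult.commute)

lemma dir_deriv_mult: "dir_deriv X p (f * g) = dir_deriv X p f * g + f * dir_deriv X p g"
proof -
  have "cscale (p v) (partial_deriv v (f * g)) =
      cscale (p v) (partial_deriv v f) * g + f * cscale (p v) (partial_deriv v g)" for v
    by (simp add: partial_deriv_mult cscale_eq_mult algebra_simps)
  then show ?thesis by (simp add: dir_deriv_def sum.distrib sum_distrib_left sum_distrib_right)
qed

lemma dir_deriv_linear:
  assumes "finite X" "l \<in> forms X 1"
  shows "dir_deriv X p l = single 0 (cpoly_eval p l)"
proof -
  have "single (0 :: 'a \<Rightarrow>\<^sub>0 nat) (\<Sum>v\<in>S. f v) = (\<Sum>v\<in>S. single 0 (f v))" for S and f :: "'a \<Rightarrow> complex"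
    by (induction S rule: infinite_finite_induct) (simp_all add: single_add)
  then show ?thesis
    by (simp add: dir_deriv_def partial_deriv_linear[OF assms(2)] eval_linear_form[OF assms]
        cscale_eq_mult mult_single mult.commute)
qed

lemma dir_deriv_power:
  assumes "finite X" "l \<in> forms X 1"
  shows "dir_deriv X p (l ^ n) = cscale (of_nat n * cpoly_eval p l) (l ^ (n - 1))"
proof -
  have "dir_deriv X p (l ^ n) = (\<Sum>v\<in>X. cscale (of_nat n * (lcoeff l v * p v)) (l ^ (n - 1)))"
    by (simp add: dir_deriv_def partial_deriv_power[OF assms(2)] mult_ac)
  also have "\<dots> = cscale (of_nat n * cpoly_eval p l) (l ^ (n - 1))"
    by (simp add: eval_linear_form[OF assms] sum_distrib_left flip: cpoly.scale_sum_left)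
  finally show ?thesis .
qed

lemma dir_deriv_prod_eq_0:
  assumes "\<And>i. i \<in> I \<Longrightarrow> dir_deriv X p (w i) = 0"
  shows "dir_deriv X p (\<Prod>i\<in>I. w i) = 0"
proof -
  have "dir_deriv X p 1 = 0"
    by (simp add: dir_deriv_def)
  then show ?thesis using assms
    by (induction I rule: infinite_finite_induct) (simp_all add: dir_deriv_mult)
qed

lemma dir_deriv_sym_power_eq_0:
  assumes "finite X" "W \<subseteq> forms X 1" "\<And>w. w \<in> W \<Longrightarrow> cpoly_eval p w = 0" "F \<in> sym_power d W"
  shows "dir_deriv X p F = 0"
proof -
  have "cpoly.span {\<Prod>i<d. w i | w. \<forall>i<d. w i \<in> W} \<subseteq> {f. dir_deriv X p f = 0}"
  proof (rule cpoly.span_minimal)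
    show "{\<Prod>i<d. w i | w. \<forall>i<d. w i \<in> W} \<subseteq> {f. dir_deriv X p f = 0}"
    proof clarify
      fix w :: "nat \<Rightarrow> 'a cpoly" assume w: "\<forall>i<d. w i \<in> W"
      have "dir_deriv X p (w i) = 0" if "i < d" for i
      proof -
        have "w i \<in> forms X 1" "cpoly_eval p (w i) = 0" using w that assms by auto
        then show ?thesis using dir_deriv_linear[OF assms(1)] by simp
      qed
      then show "dir_deriv X p (\<Prod>i<d. w i) = 0" by (intro dir_deriv_prod_eq_0) auto
    qed
    show "cpoly.subspace {f. dir_deriv X p f = 0}"
      by (rule cpoly.subspaceI) (auto simp: dir_deriv_add dir_deriv_cscale)
  qed
  then show ?thesis using assms(4) by (auto simp: sym_power_def)
qed

lemma dir_deriv_forms: "f \<in> forms X d \<Longrightarrow> dir_deriv Y p f \<in> forms X (d - 1)"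
  unfolding dir_deriv_def
  by (intro cpoly.subspace_sum cpoly.subspace_scale subspace_forms partial_deriv_forms)

lemma forms_independent:
  assumes "finite I" "disjoint_family_on X I" "e > 0" "\<And>i. i \<in> I \<Longrightarrow> f i \<in> forms (X i) e"
    and zero: "(\<Sum>i\<in>I. f i) = 0" and i: "i \<in> I"
  shows "f i = 0"
proof (rule poly_mapping_eqI)
  fix m
  show "lookup (f i) m = lookup 0 m"
  proof (cases "m \<in> keys (f i)")
    case True
    then have m: "keys m \<subseteq> X i" "m \<noteq> 0" using assms(3) assms(4)[OF i] by (auto simp: forms_def polys_def)
    have "lookup (f j) m = 0" if "j \<in> I" "j \<noteq> i" for j
    proof (rule ccontr)
      assume "lookup (f j) m \<noteq> 0"
      then have "keys m \<subseteq> X j" using assms(4)[OF that(1)] by (auto simp: forms_def polys_def in_keys_iff)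
      moreover have "X i \<inter> X j = {}" using assms(2) i that by (auto simp: disjoint_family_on_def)
      ultimately have "keys m = {}" using m by blast
      with m(2) show False by simp
    qed
    then have "(\<Sum>j\<in>I - {i}. lookup (f j) m) = 0" by (intro sum.neutral) auto
    then have "lookup (f i) m = (\<Sum>j\<in>I. lookup (f j) m)"
      using assms(1) i by (simp add: sum.remove)
    also have "\<dots> = 0" using zero by (simp flip: lookup_sum)
    finally show ?thesis by simp
  qed (simp add: in_keys_iff)
qed

text \<open>
  No derivative in a direction \<open>p \<noteq> 0\<close> vanishes for a concise sum of \<open>d\<close>-th powers. Suppose that \<open>p v0 \<noteq> 0\<close> and
  write \<open>x\<close> for the variable \<open>v0\<close> and \<open>c\<^sub>j = l\<^sub>j(p) / p v0\<close>. Repeated differentiation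
  gives \<open>\<Sum> c\<^sub>j\<^sup>k l\<^sub>j\<^bsup>d-k\<^esup> = 0\<close> for \<open>1 \<le> k \<le> d\<close>, so \<open>F = \<Sum> (l\<^sub>j - c\<^sub>j x)\<^sup>d\<close> by the binomial theorem.
  The linear forms \<open>l\<^sub>j - c\<^sub>j x\<close> all vanish at \<open>p\<close>, but \<open>x\<close> does not.
\<close>

lemma concise_dir_deriv:
  assumes X: "finite X" and conc: "concise X d F" and d: "d \<ge> 1"
    and l: "\<And>j. j < r \<Longrightarrow> l j \<in> forms X 1" and F: "F = (\<Sum>j<r. l j ^ d)"
    and zero: "dir_deriv X p F = 0" and v0: "v0 \<in> X"
  shows "p v0 = 0"
proof (rule ccontr)
  assume p: "p v0 \<noteq> 0"
  define c where "c j = cpoly_eval p (l j) / p v0" for j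
  have c: "cpoly_eval p (l j) = p v0 * c j" for j using p by (simp add: c_def)
  have dd: "dir_deriv X p (\<Sum>j<r. cscale (c j ^ k) (l j ^ n)) =
      cscale (of_nat n * p v0) (\<Sum>j<r. cscale (c j ^ Suc k) (l j ^ (n - 1)))" for k n
  proof -
    have "dir_deriv X p (cscale (c j ^ k) (l j ^ n)) =
        cscale (of_nat n * p v0) (cscale (c j ^ Suc k) (l j ^ (n - 1)))" if "j < r" for j
      using dir_deriv_power[OF X l[OF that], of p n] by (simp add: dir_deriv_cscale c mult_ac)
    then show ?thesis unfolding dir_deriv_sum cpoly.scale_sum_right
      by (intro sum.cong) auto
  qed
  have rel: "(\<Sum>j<r. cscale (c j ^ Suc k) (l j ^ (d - Suc k))) = 0" if "k < d" for k
    using that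
  proof (induction k)
    case 0
    then show ?case using dd[of 0 d] zero p d by (simp add: F)
  next
    case (Suc k)
    have "dir_deriv X p (\<Sum>j<r. cscale (c j ^ Suc k) (l j ^ (d - Suc k))) = 0"
      using Suc by simp
    then have "cscale (of_nat (d - Suc k) * p v0)
        (\<Sum>j<r. cscale (c j ^ Suc (Suc k)) (l j ^ (d - Suc k - 1))) = 0"
      unfolding dd .
    moreover have "of_nat (d - Suc k) * p v0 \<noteq> 0"
      unfolding mult_eq_0_iff of_nat_eq_0_iff using p Suc.prems by simp
    ultimately have "(\<Sum>j<r. cscale (c j ^ Suc (Suc k)) (l j ^ (d - Suc k - 1))) = 0"
      by (simp only: cpoly.scale_eq_0_iff) simp
    then show ?case by simp
  qed
  define l' where "l' j = - cscale (c j) (var v0) + l j" for j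
  have "(\<Sum>j<r. l' j ^ d) = (\<Sum>k\<le>d. of_nat (d choose k) * (- var v0) ^ k * (\<Sum>j<r. cscale (c j ^ k) (l j ^ (d - k))))"
  proof -
    have pw: "(- cscale (c j) (var v0)) ^ k = single 0 (c j ^ k) * (- var v0) ^ k" for j k
    proof (induction k)
      case (Suc k)
      have "single 0 (c j ^ Suc k) = single 0 (c j) * single (0 :: 'a \<Rightarrow>\<^sub>0 nat) (c j ^ k)"
        by (simp add: mult_single)
      then show ?case using Suc by (simp add: cscale_eq_mult mult_ac)
    qed simp
    have "l' j ^ d = (\<Sum>k\<le>d. of_nat (d choose k) * (- var v0) ^ k * cscale (c j ^ k) (l j ^ (d - k)))" for j
      unfolding l'_def binomial_ring pw by (simp add: cscale_eq_mult mult_ac)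
    then show ?thesis
      by (simp add: sum_distrib_left) (rule sum.swap)
  qed
  also have "\<dots> = (\<Sum>k\<in>{0}. of_nat (d choose k) * (- var v0) ^ k * (\<Sum>j<r. cscale (c j ^ k) (l j ^ (d - k))))"
  proof (intro sum.mono_neutral_right ballI)
    fix k assume "k \<in> {..d} - {0}"
    then have "k - 1 < d" "Suc (k - 1) = k" by auto
    then have "(\<Sum>j<r. cscale (c j ^ k) (l j ^ (d - k))) = 0" using rel[of "k - 1"] by simp
    then show "of_nat (d choose k) * (- var v0) ^ k * (\<Sum>j<r. cscale (c j ^ k) (l j ^ (d - k))) = 0"
      by simp
  qed auto
  also have "\<dots> = F" by (simp add: F)
  finally have F': "F = (\<Sum>j<r. l' j ^ d)" by simp
  define W where "W = {w \<in> forms X 1. cpoly_eval p w = 0}"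
  have "cpoly.subspace W"
    unfolding W_def by (rule cpoly.subspaceI)
      (auto intro: cpoly.subspace_0 cpoly.subspace_add cpoly.subspace_scale subspace_forms)
  moreover have "W \<subseteq> forms X 1" by (auto simp: W_def)
  moreover have "l' j \<in> W" if "j < r" for j
    unfolding W_def l'_def using l[OF that] c[of j] forms_var[OF v0] subspace_forms[of X 1]
    by (auto intro!: cpoly.subspace_diff cpoly.subspace_scale)
  then have "F \<in> sym_power d W" unfolding F' by (intro sum_powers_in_sym_power) auto
  ultimately have "W = forms X 1" using conc by (simp add: concise_def)
  then have "var v0 \<in> W" using forms_var[OF v0] by simp
  with p show False by (simp add: W_def)
qed

text \<open>
  The point \<open>p\<close> consists of the values on the variables of a linear functional that vanishes on
  \<open>W\<close> but not on all linear forms.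
\<close>

lemma separating_point:
  assumes X: "finite X" and W: "cpoly.subspace W" "W \<subseteq> forms X 1" "W \<noteq> forms X 1"
  obtains p v where "v \<in> X" "p v \<noteq> 0" "\<And>w. w \<in> W \<Longrightarrow> cpoly_eval p w = 0"
proof -
  interpret vector_space_pair "cscale :: complex \<Rightarrow> 'a cpoly \<Rightarrow> 'a cpoly" "(*) :: complex \<Rightarrow> complex \<Rightarrow> complex"
    by unfold_locales (simp_all add: algebra_simps)
  obtain w0 where w0: "w0 \<in> forms X 1" "w0 \<notin> W" using W(2,3) by blast
  obtain B where B: "B \<subseteq> W" "cpoly.independent B" "W \<subseteq> cpoly.span B"
    by (rule cpoly.basis_exists[of W])
  have "cpoly.span B \<subseteq> W" using B(1) W(1) by (rule cpoly.span_minimal)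
  then have "w0 \<notin> cpoly.span B" using w0 by auto
  then have "cpoly.independent (insert w0 B)" using B(2) by (simp add: cpoly.independent_insertI)
  from linear_independent_extend[OF this, of "\<lambda>x. if x = w0 then 1 else 0"]
  obtain g where g: "Vector_Spaces.linear cscale (*) g" "\<And>x. x \<in> insert w0 B \<Longrightarrow> g x = (if x = w0 then 1 else 0)" by blast
  interpret g: Vector_Spaces.linear cscale "(*)" g by (rule g(1))
  have "g w = 0" if "w \<in> W" for w
  proof -
    have "\<forall>b\<in>B. g b = 0" using g(2) \<open>w0 \<notin> cpoly.span B\<close> cpoly.span_base[of w0 B] by auto
    then have "cpoly.span B \<subseteq> {x. g x = 0}"
      by (intro cpoly.span_minimal cpoly.subspaceI) (auto simp: g.add g.scale)
    then show ?thesis using that B(3) by auto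
  qed
  moreover have eval: "cpoly_eval (\<lambda>v. g (var v)) w = g w" if "w \<in> forms X 1" for w
    by (subst (2) linear_form_eq_sum[OF X that])
      (simp add: eval_linear_form[OF X that] g.sum g.scale)
  moreover have "\<exists>v\<in>X. g (var v) \<noteq> 0"
  proof (rule ccontr)
    assume "\<not> ?thesis"
    then have "g w0 = 0" using eval[OF w0(1)] eval_linear_form[OF X w0(1)] by simp
    then show False using g(2)[of w0] by simp
  qed
  ultimately show thesis using that[of _ "\<lambda>v. g (var v)"] W(2) by fastforce
qed

lemma concise_sum:
  assumes I: "finite I" and X: "\<And>i. i \<in> I \<Longrightarrow> finite (X i)" and disj: "disjoint_family_on X I"
    and F: "\<And>i. i \<in> I \<Longrightarrow> F i \<in> forms (X i) d" and conc: "\<And>i. i \<in> I \<Longrightarrow> concise (X i) d (F i)"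
    and d: "d \<ge> 2" and fin: "\<And>i. i \<in> I \<Longrightarrow> waring_rank d (F i) \<noteq> \<infinity>"
  shows "concise (\<Union>i\<in>I. X i) d (\<Sum>i\<in>I. F i)"
  unfolding concise_def
proof (intro allI impI, rule ccontr)
  let ?X = "\<Union>i\<in>I. X i"
  fix W assume W: "cpoly.subspace W \<and> W \<subseteq> forms ?X 1 \<and> (\<Sum>i\<in>I. F i) \<in> sym_power d W"
    and ne: "W \<noteq> forms ?X 1"
  have finX: "finite ?X" using I X by auto
  obtain p v where p: "v \<in> ?X" "p v \<noteq> 0" "\<And>w. w \<in> W \<Longrightarrow> cpoly_eval p w = 0"
    using separating_point[OF finX] W ne by metis
  have "dir_deriv ?X p (\<Sum>i\<in>I. F i) = 0"
    using dir_deriv_sym_power_eq_0[OF finX] W p(3) by blast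
  moreover have "dir_deriv ?X p (F i) = dir_deriv (X i) p (F i)" if "i \<in> I" for i
  proof -
    have "F i \<in> polys (X i)" using F[OF that] forms_subset_polys by blast
    then show ?thesis unfolding dir_deriv_def using that finX
      by (intro sum.mono_neutral_right) (auto simp: partial_deriv_eq_0)
  qed
  ultimately have sum0: "(\<Sum>i\<in>I. dir_deriv (X i) p (F i)) = 0" by (simp add: dir_deriv_sum)
  obtain i where i: "i \<in> I" "v \<in> X i" using p(1) by auto
  have "dir_deriv (X i) p (F i) = 0"
    using d by (intro forms_independent[OF I disj _ dir_deriv_forms[OF F] sum0 i(1)]) auto
  moreover obtain r where "waring_rank d (F i) = enat r" using fin[OF i(1)] by auto
  then obtain l where "\<And>j. j < r \<Longrightarrow> l j \<in> forms (X i) 1" "F i = (\<Sum>j<r. l j ^ d)"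
    using waring_rank_decomposition F[OF i(1)] forms_subset_polys by (metis subsetD)
  ultimately have "p v = 0"
    using concise_dir_deriv[OF X[OF i(1)] conc[OF i(1)]] d i(2) by (metis Suc_1 Suc_leD)
  with p(2) show False by simp
qed

section \<open>Derivatives and singular loci of a sum\<close>

text \<open>
  Bases of the spans of sets \<open>U\<^sub>i\<close> of forms of positive degree in disjoint sets of variables are disjoint, and
  their union is independent. The space \<open>V\<close> has to be of finite dimension, since infinite
  dimensions have the value 0.
\<close>

lemma dim_sum_forms_le:
  assumes I: "finite I" and disj: "disjoint_family_on X I" and e: "e > 0"
    and U: "\<And>i. i \<in> I \<Longrightarrow> U i \<subseteq> forms (X i) e" "\<And>i. i \<in> I \<Longrightarrow> U i \<subseteq> V"
    and V: "V \<subseteq> cpoly.span S" "finite S"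
  shows "(\<Sum>i\<in>I. cpoly.dim (U i)) \<le> cpoly.dim V"
proof -
  have "\<forall>i. \<exists>B. B \<subseteq> U i \<and> cpoly.independent B \<and> U i \<subseteq> cpoly.span B \<and> card B = cpoly.dim (U i)"
  proof
    fix i
    obtain B where "B \<subseteq> U i" "cpoly.independent B" "U i \<subseteq> cpoly.span B" "card B = cpoly.dim (U i)"
      by (rule cpoly.basis_exists[of "U i"])
    then show "\<exists>B. B \<subseteq> U i \<and> cpoly.independent B \<and> U i \<subseteq> cpoly.span B \<and> card B = cpoly.dim (U i)"
      by blast
  qed
  from choice[OF this] obtain B where B: "\<And>i. B i \<subseteq> U i" "\<And>i. cpoly.independent (B i)"
    "\<And>i. card (B i) = cpoly.dim (U i)" by blast
  have finB: "finite (B i)" if "i \<in> I" for i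
    using cpoly.independent_span_bound[OF V(2) B(2)[of i]] B(1)[of i] U(2)[OF that] V(1) by blast
  have nz: "0 \<notin> B i" for i using B(2)[of i] cpoly.dependent_zero by blast
  have disjB: "B i \<inter> B j = {}" if ij: "i \<in> I" "j \<in> I" "i \<noteq> j" for i j
  proof (rule ccontr)
    assume "B i \<inter> B j \<noteq> {}"
    then obtain x where x: "x \<in> B i" "x \<in> B j" by auto
    then have "x \<in> forms (X i) e" "x \<in> forms (X j) e" using B(1) U(1) ij by blast+
    then have x': "x \<in> forms (X i) e" "- x \<in> forms (X j) e"
      by (simp_all add: cpoly.subspace_neg[OF subspace_forms])
    define f where "f k = (if k = i then x else if k = j then - x else 0)" for k
    have "(\<Sum>k\<in>{i, j}. f k) = 0" using ij by (simp add: f_def)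
    then have "f i = 0"
    proof (rule forms_independent[of "{i, j}" X e f i, rotated 4])
      show "disjoint_family_on X {i, j}" using disj ij by (auto simp: disjoint_family_on_def)
      show "f k \<in> forms (X k) e" if "k \<in> {i, j}" for k
        using that x' by (auto simp: f_def)
    qed (use e in auto)
    then show False using x nz by (auto simp: f_def)
  qed
  have finU: "finite (\<Union>i\<in>I. B i)" using I finB by auto
  have "cpoly.independent (\<Union>i\<in>I. B i)"
  proof
    assume "cpoly.dependent (\<Union>i\<in>I. B i)"
    then obtain u where u: "\<exists>x\<in>(\<Union>i\<in>I. B i). u x \<noteq> 0" "(\<Sum>x\<in>(\<Union>i\<in>I. B i). cscale (u x) x) = 0"
      using cpoly.dependent_finite[OF finU] by auto
    have "(\<Sum>i\<in>I. \<Sum>x\<in>B i. cscale (u x) x) = 0"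
      using u(2) I finB disjB by (subst (asm) sum.UNION_disjoint) auto
    then have "(\<Sum>x\<in>B i. cscale (u x) x) = 0" if "i \<in> I" for i
      using forms_independent[OF I disj e, of "\<lambda>i. \<Sum>x\<in>B i. cscale (u x) x"] that B(1) U(1)
        subspace_forms by (blast intro: cpoly.subspace_sum cpoly.subspace_scale)
    then have "\<forall>x\<in>B i. u x = 0" if "i \<in> I" for i
      using that cpoly.dependent_finite[OF finB] B(2) by blast
    then show False using u(1) by auto
  qed
  moreover obtain C where C: "C \<subseteq> V" "cpoly.independent C" "V \<subseteq> cpoly.span C" "card C = cpoly.dim V"
    by (rule cpoly.basis_exists[of V])
  have "finite C" using cpoly.independent_span_bound[OF V(2) C(2)] C(1) V(1) by auto
  ultimately have "card (\<Union>i\<in>I. B i) \<le> card C"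
    using B(1) U(2) C(3) by (intro cpoly.independent_span_bound[THEN conjunct2]) blast+
  moreover have "card (\<Union>i\<in>I. B i) = (\<Sum>i\<in>I. card (B i))"
    using I finB disjB by (intro card_UN_disjoint) auto
  ultimately show ?thesis by (simp add: B(3) C(4))
qed

lemma partial_derivs_disjoint_sum:
  assumes "finite I" "disjoint_family_on X I" "\<And>i. i \<in> I \<Longrightarrow> F i \<in> polys (X i)"
    and i: "i \<in> I" and vs: "set vs \<subseteq> X i" "vs \<noteq> []"
  shows "partial_derivs vs (\<Sum>j\<in>I. F j) = partial_derivs vs (F i)"
proof -
  have "partial_derivs vs (F j) = 0" if "j \<in> I" "j \<noteq> i" for j
  proof (rule partial_derivs_eq_0[OF assms(3)[OF that(1)]])
    have "X i \<inter> X j = {}" using assms(2) i that by (auto simp: disjoint_family_on_def)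
    moreover have "hd vs \<in> set vs" using vs(2) by simp
    ultimately show "\<not> set vs \<subseteq> X j" using vs(1) by blast
  qed
  then have "(\<Sum>j\<in>I - {i}. partial_derivs vs (F j)) = 0" by (intro sum.neutral) auto
  then show ?thesis using assms(1) i
    unfolding partial_derivs_sum by (simp add: sum.remove)
qed

lemma dim_derivs_sum_ge:
  assumes I: "finite I" and X: "\<And>i. i \<in> I \<Longrightarrow> finite (X i)" and disj: "disjoint_family_on X I"
    and F: "\<And>i. i \<in> I \<Longrightarrow> F i \<in> forms (X i) d" and a: "1 \<le> a" "a \<le> d - 1"
  shows "(\<Sum>i\<in>I. cpoly.dim (derivs_space (X i) d (F i) (d - a))) \<le>
    cpoly.dim (derivs_space (\<Union>i\<in>I. X i) d (\<Sum>i\<in>I. F i) (d - a))"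
proof -
  let ?X = "\<Union>i\<in>I. X i" and ?F = "\<Sum>i\<in>I. F i"
  define S where "S = {partial_derivs vs ?F | vs. set vs \<subseteq> ?X \<and> length vs = d - (d - a)}"
  have len: "d - (d - a) = a" using a by auto
  have "finite {vs. set vs \<subseteq> ?X \<and> length vs = d - (d - a)}"
    using I X by (intro finite_lists_length_eq) auto
  then have S: "finite S" unfolding S_def by (auto simp: setcompr_eq_image)
  show ?thesis
  proof (rule dim_sum_forms_le[OF I disj _ _ _ _ S, of "d - a"])
    show "d - a > 0" using a by auto
    show "derivs_space ?X d ?F (d - a) \<subseteq> cpoly.span S" by (simp add: derivs_space_def S_def)
    fix i assume i: "i \<in> I"
    show "derivs_space (X i) d (F i) (d - a) \<subseteq> forms (X i) (d - a)"
      unfolding derivs_space_def len using partial_derivs_forms[OF F[OF i]]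
      by (intro cpoly.span_minimal subspace_forms) auto
    have "partial_derivs vs (F i) \<in> S" if "set vs \<subseteq> X i" "length vs = a" for vs
    proof -
      have "vs \<noteq> []" using that a by auto
      then have "partial_derivs vs ?F = partial_derivs vs (F i)"
        using F forms_subset_polys i that(1) by (intro partial_derivs_disjoint_sum[OF I disj]) blast+
      then show ?thesis unfolding S_def len using that i by force
    qed
    then show "derivs_space (X i) d (F i) (d - a) \<subseteq> derivs_space ?X d ?F (d - a)"
      unfolding derivs_space_def len S_def[unfolded len, symmetric] by (intro cpoly.span_mono) blast
  qed
qed

lemma Sigma_locus_zero:
  assumes "F \<in> forms X d" "a \<le> d - 1" "1 \<le> a"
  shows "(\<lambda>_. 0) \<in> Sigma_locus X a F"
  unfolding Sigma_locus_def
proof (intro CollectI conjI allI impI)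
  fix vs assume vs: "set vs \<subseteq> X \<and> length vs \<le> a"
  show "cpoly_eval (\<lambda>_. 0) (partial_derivs vs F) = 0"
    by (rule eval_form_at_0[OF partial_derivs_forms[OF assms(1)]]) (use vs assms in auto)
qed (simp add: dual_space_def)

lemma product_subset_Sigma_locus:
  assumes F: "\<And>i. i \<in> I \<Longrightarrow> F i \<in> polys (X i)"
  shows "{p \<in> dual_space (\<Union>i\<in>I. X i). \<forall>i\<in>I. restr (X i) p \<in> Sigma_locus (X i) a (F i)} \<subseteq>
    Sigma_locus (\<Union>i\<in>I. X i) a (\<Sum>i\<in>I. F i)"
proof
  fix p
  assume p: "p \<in> {p \<in> dual_space (\<Union>i\<in>I. X i). \<forall>i\<in>I. restr (X i) p \<in> Sigma_locus (X i) a (F i)}"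
  have "cpoly_eval p (partial_derivs vs (\<Sum>i\<in>I. F i)) = 0" if "length vs \<le> a" for vs
  proof -
    have "cpoly_eval p (partial_derivs vs (F i)) = 0" if i: "i \<in> I" for i
    proof (cases "set vs \<subseteq> X i")
      case True
      then have "cpoly_eval (restr (X i) p) (partial_derivs vs (F i)) = 0"
        using p i \<open>length vs \<le> a\<close> by (auto simp: Sigma_locus_def)
      moreover have "partial_derivs vs (F i) \<in> polys (X i)"
        using F[OF i] by (rule partial_derivs_polys)
      ultimately show ?thesis by (simp add: eval_restr)
    next
      case False
      then show ?thesis by (simp add: partial_derivs_eq_0[OF F[OF i]])
    qed
    then show ?thesis by (simp add: partial_derivs_sum)
  qed
  with p show "p \<in> Sigma_locus (\<Union>i\<in>I. X i) a (\<Sum>i\<in>I. F i)" by (auto simp: Sigma_locus_def)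
qed

section \<open>Additivity of the rank\<close>

theorem theorem2p11:
  fixes k d a :: nat
    and X :: "nat \<Rightarrow> 'v set"
    and F :: "nat \<Rightarrow> 'v cpoly"
  assumes "\<And>i. i \<in> {1..k} \<Longrightarrow> finite (X i)"
    and "disjoint_family_on X {1..k}"
    and "\<And>i. i \<in> {1..k} \<Longrightarrow> F i \<in> forms (X i) d"
    and "\<And>i. i \<in> {1..k} \<Longrightarrow> concise (X i) d (F i)"
    and "1 \<le> a" and "a \<le> d - 1"
    and "\<And>i. i \<in> {1..k} \<Longrightarrow>
      waring_rank d (F i) =
        enat (cpoly.dim (derivs_space (X i) d (F i) (d - a)))
        + alg_dim (X i) (Sigma_locus (X i) a (F i))"
  shows "concise (\<Union>i\<in>{1..k}. X i) d (\<Sum>i=1..k. F i)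
    \<and> waring_rank d (\<Sum>i=1..k. F i) =
        enat (cpoly.dim (derivs_space (\<Union>i\<in>{1..k}. X i) d (\<Sum>i=1..k. F i) (d - a)))
        + alg_dim (\<Union>i\<in>{1..k}. X i) (Sigma_locus (\<Union>i\<in>{1..k}. X i) a (\<Sum>i=1..k. F i))
    \<and> waring_rank d (\<Sum>i=1..k. F i) = (\<Sum>i=1..k. waring_rank d (F i))"
proof -
  define I where "I = {1..k}"
  let ?X = "\<Union>i\<in>I. X i" and ?F = "\<Sum>i\<in>I. F i"
  let ?lower = "enat (cpoly.dim (derivs_space ?X d ?F (d - a))) + alg_dim ?X (Sigma_locus ?X a ?F)"
  note X = assms(1)[folded I_def] and disj = assms(2)[folded I_def] and F = assms(3)[folded I_def]
    and conc = assms(4)[folded I_def] and a = assms(5,6) and rank = assms(7)[folded I_def]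
  have I: "finite I" by (simp add: I_def)
  have polys: "F i \<in> polys (X i)" if "i \<in> I" for i using F[OF that] forms_subset_polys by blast
  \<comment> \<open>The rank is finite since the dimension of the locus is at most the number of variables.\<close>
  have fin: "waring_rank d (F i) \<noteq> \<infinity>" if "i \<in> I" for i
    using alg_dim_le_card_vars[OF X[OF that], of "Sigma_locus (X i) a (F i)"]
    by (cases "alg_dim (X i) (Sigma_locus (X i) a (F i))") (simp_all add: rank[OF that])
  have concise: "concise ?X d ?F"
    using a by (intro concise_sum I X disj F conc fin) auto
  have le: "waring_rank d ?F \<le> (\<Sum>i\<in>I. waring_rank d (F i))" by (rule waring_rank_sum_le)
  have "(\<Sum>i\<in>I. waring_rank d (F i)) =
      enat (\<Sum>i\<in>I. cpoly.dim (derivs_space (X i) d (F i) (d - a))) +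
      (\<Sum>i\<in>I. alg_dim (X i) (Sigma_locus (X i) a (F i)))"
    by (simp add: rank sum.distrib flip: of_nat_eq_enat)
  also have "\<dots> \<le> ?lower"
  proof (intro add_mono)
    show "enat (\<Sum>i\<in>I. cpoly.dim (derivs_space (X i) d (F i) (d - a))) \<le>
        enat (cpoly.dim (derivs_space ?X d ?F (d - a)))"
      using dim_derivs_sum_ge[OF I X disj F a] by simp
    have "(\<Sum>i\<in>I. alg_dim (X i) (Sigma_locus (X i) a (F i))) \<le>
        alg_dim ?X {p \<in> dual_space ?X. \<forall>i\<in>I. restr (X i) p \<in> Sigma_locus (X i) a (F i)}"
      using a by (intro alg_dim_product_ge I disj Sigma_locus_zero[OF F])
    also have "\<dots> \<le> alg_dim ?X (Sigma_locus ?X a ?F)"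
      by (intro alg_dim_mono product_subset_Sigma_locus polys)
    finally show "(\<Sum>i\<in>I. alg_dim (X i) (Sigma_locus (X i) a (F i))) \<le> alg_dim ?X (Sigma_locus ?X a ?F)" .
  qed
  finally have ge: "(\<Sum>i\<in>I. waring_rank d (F i)) \<le> ?lower" .
  have "?lower \<le> waring_rank d ?F"
  proof (cases "waring_rank d ?F")
    case (enat r)
    have "?F \<in> polys ?X"
      using polys polys_mono[of "X _" ?X] by (intro sum_in_polys) blast
    then obtain l where "\<And>j. j < r \<Longrightarrow> l j \<in> forms ?X 1" "?F = (\<Sum>j<r. l j ^ d)"
      using waring_rank_decomposition[OF enat] by blast
    then show ?thesis unfolding enat using I X a by (intro landsberg_teitler_bound concise) auto
  qed simp
  with le ge have "waring_rank d ?F = ?lower" "waring_rank d ?F = (\<Sum>i\<in>I. waring_rank d (F i))"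
    by (auto intro: order.antisym order.trans)
  with concise show ?thesis unfolding I_def by blast
qed

end
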